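(* Let $n,k$ be integers with $2\leq k\leq n-17$, and let $G$ be a connected graph of order $n$ (so $n\geq k+17$) with minimum degree $\delta\geq k+1$. If $$HM(\overline{G})\leq(n-k)^{2}[3(n-k)-11],$$ then $G$ is $k$-leaf-connected unless the closure $C_{n+k-1}(G)$ is (isomorphic to) a member of $\{K_{k}\vee (K_{n-k-2}+K_{2}),\ K_{3}\vee (K_{n-5}+2K_{1})\}$.
   Context: All graphs are finite, simple and undirected; the order of $G$ is $|V(G)|$. $d_G(v)$ is the degree of the vertex $v$ in $G$, $\delta=\delta(G)$ is the minimum degree, and $\overline{G}$ is the complement of $G$. The hyper-Zagreb index of a graph $H$ is $HM(H)=\sum_{uv\in E(H)}\big(d_{H}(u)+d_{H}(v)\big)^{2}$. For $k\geq 2$, a graph $G$ with $|V(G)|\geq k+1$ is $k$-leaf-connected if for every subset $S\subseteq V(G)$ with $|S|=k$, $G$ has a spanning tree $T$ such that $S$ is precisely the set of leaves of $T$. For an integer $l\geq 0$, the $l$-closure $C_l(G)$ of $G$ is the graph obtained from $G$ by successively joining pairs of nonadjacent vertices whose degree sum (in the current graph) is at least $l$, until no such pair exists. For vertex-disjoint graphs $G$ and $H$, $G+H$ is their disjoint union, $tG$ is the disjoint union of $t$ copies of $G$, and the join $G\vee H$ is obtained from $G+H$ by adding all possible edges between $V(G)$ and $V(H)$. $K_n$ is the complete graph of order $n$. *)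

theory Defs
  imports Main
begin

datatype 'a graph = Graph (verts: "'a set") (edges: "'a set set")

definition simple_graph :: "'a graph \<Rightarrow> bool" where
  "simple_graph G \<longleftrightarrow> finite (verts G) \<and> (\<forall>e\<in>edges G. e \<subseteq> verts G \<and> card e = 2)"

definition graph_order :: "'a graph \<Rightarrow> nat" where
  "graph_order G = card (verts G)"

definition degree :: "'a graph \<Rightarrow> 'a \<Rightarrow> nat" where
  "degree G v = card {e \<in> edges G. v \<in> e}"

text \<open>Only meaningful when \<open>verts G\<close> is nonempty.\<close>

definition min_degree :: "'a graph \<Rightarrow> nat" where
  "min_degree G = Min (degree G ` verts G)"

definition graph_complement :: "'a graph \<Rightarrow> 'a graph" where
  "graph_complement G = Graph (verts G)
     {{u, v} |u v. u \<in> verts G \<and> v \<in> verts G \<and> u \<noteq> v \<and> {u, v} \<notin> edges G}"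

text \<open>For an edge \<open>e = {u, v}\<close>, with \<open>u \<noteq> v\<close>, the inner sum is \<open>degree G u + degree G v\<close>.\<close>

definition hyper_Zagreb :: "'a graph \<Rightarrow> nat" where
  "hyper_Zagreb G = (\<Sum>e\<in>edges G. (\<Sum>v\<in>e. degree G v)\<^sup>2)"

definition connected_graph :: "'a graph \<Rightarrow> bool" where
  "connected_graph G \<longleftrightarrow> verts G \<noteq> {} \<and>
     (\<forall>u\<in>verts G. \<forall>v\<in>verts G. (\<lambda>x y. {x, y} \<in> edges G)\<^sup>*\<^sup>* u v)"

text \<open>A cycle is given by the cyclic list of its vertices.\<close>

definition is_cycle :: "'a graph \<Rightarrow> 'a list \<Rightarrow> bool" where
  "is_cycle G c \<longleftrightarrow> 3 \<le> length c \<and> distinct c \<and>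
     (\<forall>i<length c. {c ! i, c ! (Suc i mod length c)} \<in> edges G)"

definition tree :: "'a graph \<Rightarrow> bool" where
  "tree T \<longleftrightarrow> simple_graph T \<and> connected_graph T \<and> (\<nexists>c. is_cycle T c)"

definition spanning_tree :: "'a graph \<Rightarrow> 'a graph \<Rightarrow> bool" where
  "spanning_tree T G \<longleftrightarrow> tree T \<and> verts T = verts G \<and> edges T \<subseteq> edges G"

definition leaves :: "'a graph \<Rightarrow> 'a set" where
  "leaves T = {v \<in> verts T. degree T v = 1}"

text \<open>The notion is intended for \<open>k \<ge> 2\<close>.\<close>

definition leaf_connected :: "nat \<Rightarrow> 'a graph \<Rightarrow> bool" where
  "leaf_connected k G \<longleftrightarrow> k + 1 \<le> graph_order G \<and>
     (\<forall>S\<subseteq>verts G. card S = k \<longrightarrow> (\<exists>T. spanning_tree T G \<and> leaves T = S))"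

definition closure_step :: "nat \<Rightarrow> 'a graph \<Rightarrow> 'a graph \<Rightarrow> bool" where
  "closure_step l G H \<longleftrightarrow> (\<exists>u\<in>verts G. \<exists>v\<in>verts G. u \<noteq> v \<and> {u, v} \<notin> edges G \<and>
     l \<le> degree G u + degree G v \<and> H = Graph (verts G) (insert {u, v} (edges G)))"

text \<open>The result does not depend on the order in which the edges are added; see
  \<open>closure_unique\<close> below.\<close>

definition graph_closure :: "nat \<Rightarrow> 'a graph \<Rightarrow> 'a graph" where
  "graph_closure l G = (THE H. (closure_step l)\<^sup>*\<^sup>* G H \<and> (\<nexists>H'. closure_step l H H'))"

definition complete_graph :: "nat \<Rightarrow> nat graph" where
  "complete_graph n = Graph {..<n} {{u, v} |u v. u < n \<and> v < n \<and> u \<noteq> v}"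

definition disjoint_union :: "'a graph \<Rightarrow> 'b graph \<Rightarrow> ('a + 'b) graph" where
  "disjoint_union G H = Graph (verts G <+> verts H)
     ((`) Inl ` edges G \<union> (`) Inr ` edges H)"

definition copies :: "nat \<Rightarrow> 'a graph \<Rightarrow> (nat \<times> 'a) graph" where
  "copies t G = Graph ({..<t} \<times> verts G) {Pair i ` e |i e. i < t \<and> e \<in> edges G}"

definition graph_join :: "'a graph \<Rightarrow> 'b graph \<Rightarrow> ('a + 'b) graph" where
  "graph_join G H = Graph (verts G <+> verts H)
     (edges (disjoint_union G H) \<union> {{Inl u, Inr v} |u v. u \<in> verts G \<and> v \<in> verts H})"

definition isomorphic :: "'a graph \<Rightarrow> 'b graph \<Rightarrow> bool" where
  "isomorphic G H \<longleftrightarrow> (\<exists>f. bij_betw f (verts G) (verts H) \<and>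
     (\<forall>u\<in>verts G. \<forall>v\<in>verts G. {u, v} \<in> edges G \<longleftrightarrow> {f u, f v} \<in> edges H))"

lemma finite_edges: "simple_graph G \<Longrightarrow> finite (edges G)"
  by (rule finite_subset[of _ "Pow (verts G)"]) (auto simp: simple_graph_def)

lemma closure_step_simple_graph:
  assumes "closure_step l G H" "simple_graph G"
  shows "simple_graph H" "verts H = verts G" "card (edges H) = Suc (card (edges G))"
    "card (edges H) \<le> card (Pow (verts G))"
proof -
  from assms(1) obtain u v where uv: "u \<in> verts G" "v \<in> verts G" "u \<noteq> v" "{u, v} \<notin> edges G"
    and H: "H = Graph (verts G) (insert {u, v} (edges G))"
    unfolding closure_step_def by blast
  show "simple_graph H" "verts H = verts G" "card (edges H) = Suc (card (edges G))"
    using uv assms(2) finite_edges[OF assms(2)] by (auto simp: H simple_graph_def)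
  then show "card (edges H) \<le> card (Pow (verts G))"
    by (metis (no_types, lifting) Pow_iff card_mono finite_Pow_iff simple_graph_def subsetI)
qed

lemma closure_steps_simple_graph:
  assumes "(closure_step l)\<^sup>*\<^sup>* G H" "simple_graph G"
  shows "simple_graph H \<and> verts H = verts G"
  using assms by (induction rule: rtranclp_induct) (auto dest: closure_step_simple_graph)

lemma closure_exists:
  assumes "simple_graph G"
  shows "\<exists>H. (closure_step l)\<^sup>*\<^sup>* G H \<and> (\<nexists>H'. closure_step l H H')"
  using assms
proof (induction "card (Pow (verts G)) - card (edges G)" arbitrary: G rule: less_induct)
  case less
  show ?case
  proof (cases "\<exists>H. closure_step l G H")
    case True
    then obtain H where H: "closure_step l G H" by blast
    note * = closure_step_simple_graph[OF H less.prems]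
    have "card (Pow (verts H)) - card (edges H) < card (Pow (verts G)) - card (edges G)"
      using *(2-4) by simp
    from less.hyps[OF this *(1)] obtain F
      where "(closure_step l)\<^sup>*\<^sup>* H F" "\<nexists>H'. closure_step l F H'" by blast
    then show ?thesis using H by (blast intro: converse_rtranclp_into_rtranclp)
  qed auto
qed

lemma closure_steps_subset_terminal:
  assumes "(closure_step l)\<^sup>*\<^sup>* G H" "simple_graph F" "verts F = verts G" "edges G \<subseteq> edges F"
    "\<nexists>H'. closure_step l F H'"
  shows "verts H = verts G \<and> edges H \<subseteq> edges F"
  using assms(1)
proof (induction rule: rtranclp_induct)
  case base
  then show ?case using assms by simp
next
  case (step H H')
  then obtain u v where uv: "u \<in> verts H" "v \<in> verts H" "u \<noteq> v"
    and d: "l \<le> degree H u + degree H v" and H': "H' = Graph (verts H) (insert {u, v} (edges H))"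
    unfolding closure_step_def by blast
  have "degree H w \<le> degree F w" for w
    unfolding degree_def using step.IH finite_edges[OF assms(2)] by (intro card_mono) auto
  with d have "l \<le> degree F u + degree F v"
    by (meson add_mono le_trans)
  then have "{u, v} \<in> edges F"
    using assms(3,5) uv step.IH unfolding closure_step_def by auto
  then show ?case using step.IH H' by auto
qed

lemma closure_unique:
  assumes "simple_graph G"
  shows "\<exists>!H. (closure_step l)\<^sup>*\<^sup>* G H \<and> (\<nexists>H'. closure_step l H H')"
proof -
  have sub: "edges G \<subseteq> edges H" if "(closure_step l)\<^sup>*\<^sup>* G H" for H
    using that by (induction rule: rtranclp_induct) (auto simp: closure_step_def)
  have "H = F"
    if H: "(closure_step l)\<^sup>*\<^sup>* G H" "\<nexists>H'. closure_step l H H'"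
      and F: "(closure_step l)\<^sup>*\<^sup>* G F" "\<nexists>H'. closure_step l F H'" for H F
    using closure_steps_subset_terminal[OF H(1) _ _ sub[OF F(1)] F(2)]
      closure_steps_subset_terminal[OF F(1) _ _ sub[OF H(1)] H(2)]
      closure_steps_simple_graph[OF H(1) assms] closure_steps_simple_graph[OF F(1) assms]
    by (auto intro: graph.expand)
  then show ?thesis using closure_exists[OF assms] by blast
qed

end

theory Submission
  imports Defs
begin

text \<open>
  Write \<open>m = n - k\<close>. Joining two nonadjacent vertices of degree sum at least \<open>n + k - 1\<close> does not
  change, for any \<open>k\<close>-set \<open>S\<close>, whether there is a spanning tree with leaf set \<open>S\<close>
  (\<open>leaf_tree_remove_edge\<close>): a tree that uses the new edge can be rerouted by an exchange of two edges
  that keeps every degree, in the manner of Ore's argument for Hamiltonian paths. So it suffices to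
  study the closure \<open>H\<close>.

  Let \<open>F\<close> be the complement of \<open>H\<close>. Since \<open>H\<close> is closed, the ends of every edge of \<open>F\<close> have degree
  sum at least \<open>m\<close>, and the minimum degree condition bounds the degrees in \<open>F\<close> by \<open>m - 2\<close>.
  Every term of the hyper-Zagreb index of \<open>F\<close> is therefore at least \<open>m\<close> times a degree sum, and
  double counting turns the hypothesis into \<open>(\<Sum>v. d(v)\<^sup>2) \<le> m (3 m - 11)\<close>. The vertices of degree at
  least \<open>m/2\<close> cover all edges of \<open>F\<close>; if there were three of them, the squares of their degrees and
  of the degrees of their neighbours would exceed this bound (here \<open>m \<ge> 17\<close> enters). With at most two such
  vertices, \<open>F\<close> is edgeless, or consists, apart from isolated vertices, of two vertices of
  degree \<open>m - 2\<close> joined to the same set \<open>Z\<close> of vertices of degree 2, with or without an edge between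
  the two (\<open>sparse_complement_structure\<close>).

  If \<open>F\<close> is edgeless, \<open>H\<close> is complete and all required trees exist. If the two large vertices are
  nonadjacent in \<open>F\<close>, then \<open>H\<close> is the first exceptional graph. If they are adjacent in \<open>F\<close>, then
  \<open>H\<close> is \<open>K\<^bsub>k+1\<^esub> \<or> (K\<^bsub>n-k-3\<^esub> + 2K\<^sub>1)\<close>: this is the second exceptional graph when \<open>k = 2\<close>, and it is
  \<open>k\<close>-leaf-connected when \<open>k \<ge> 3\<close> (\<open>twins_leaf_tree\<close>), because the third leaf leaves room for a branching.
\<close>

section \<open>Neighbourhoods and connectedness\<close>

definition nbrs :: "'a graph \<Rightarrow> 'a \<Rightarrow> 'a set" where
  "nbrs G v = {w. {v, w} \<in> edges G}"

lemma edgeD: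
  assumes "simple_graph G" "{u, v} \<in> edges G"
  shows "u \<in> verts G" "v \<in> verts G" "u \<noteq> v"
proof -
  have "{u, v} \<subseteq> verts G" "card {u, v} = 2"
    using assms by (auto simp: simple_graph_def)
  then show "u \<in> verts G" "v \<in> verts G" "u \<noteq> v" by auto
qed

lemma edge_cases:
  assumes "simple_graph G" "e \<in> edges G"
  obtains u v where "e = {u, v}" "u \<noteq> v" "u \<in> verts G" "v \<in> verts G"
proof -
  have "card e = 2" "e \<subseteq> verts G" using assms by (auto simp: simple_graph_def)
  then show ?thesis using that by (auto simp: card_2_iff)
qed

lemma nbrs_subset: "simple_graph G \<Longrightarrow> nbrs G v \<subseteq> verts G - {v}"
  by (auto simp: nbrs_def dest: edgeD)

lemma finite_nbrs: "simple_graph G \<Longrightarrow> finite (nbrs G v)"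
  by (rule finite_subset[OF nbrs_subset]) (auto simp: simple_graph_def)

lemma degree_eq_card_nbrs:
  assumes "simple_graph G"
  shows "degree G v = card (nbrs G v)"
proof -
  have "{e \<in> edges G. v \<in> e} = (\<lambda>w. {v, w}) ` nbrs G v"
  proof (intro equalityI subsetI)
    fix e assume e: "e \<in> {e \<in> edges G. v \<in> e}"
    then obtain a b where "e = {a, b}" by (auto elim: edge_cases[OF assms])
    with e show "e \<in> (\<lambda>w. {v, w}) ` nbrs G v"
      by (auto simp: nbrs_def insert_commute)
  qed (auto simp: nbrs_def)
  moreover have "inj_on (\<lambda>w. {v, w}) (nbrs G v)"
    by (auto simp: inj_on_def doubleton_eq_iff)
  ultimately show ?thesis
    by (simp add: degree_def card_image)
qed

definition joined :: "'a set set \<Rightarrow> 'a \<Rightarrow> 'a \<Rightarrow> bool" where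
  "joined E = (\<lambda>x y. {x, y} \<in> E)\<^sup>*\<^sup>*"

lemma joined_refl [simp]: "joined E x x"
  by (simp add: joined_def)

lemma joined_edge: "{x, y} \<in> E \<Longrightarrow> joined E x y"
  by (auto simp: joined_def)

lemma joined_trans: "joined E x y \<Longrightarrow> joined E y z \<Longrightarrow> joined E x z"
  by (auto simp: joined_def)

lemma joined_sym: "joined E x y \<Longrightarrow> joined E y x"
  unfolding joined_def
  by (rule sympD[OF symp_rtranclp]) (auto simp: symp_def insert_commute)

lemma joined_mono: "joined E x y \<Longrightarrow> E \<subseteq> E' \<Longrightarrow> joined E' x y"
  unfolding joined_def by (erule rtranclp_mono[THEN predicate2D, rotated]) auto

lemma connected_graphI:
  assumes "r \<in> verts G" "\<And>v. v \<in> verts G \<Longrightarrow> joined (edges G) v r"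
  shows "connected_graph G"
  unfolding connected_graph_def joined_def[symmetric]
  using assms by (blast intro: joined_trans joined_sym)

lemma connected_graphD:
  "connected_graph G \<Longrightarrow> u \<in> verts G \<Longrightarrow> v \<in> verts G \<Longrightarrow> joined (edges G) u v"
  by (simp add: connected_graph_def joined_def)

text \<open>Breadth-first search from the set \<open>R\<close>: the rank \<open>\<rho>\<close> is the distance to \<open>R\<close>, and the parent of a
  vertex is a neighbour that is one step closer.\<close>

lemma connected_rooted:
  assumes "simple_graph T" "connected_graph T" "R \<subseteq> verts T" "R \<noteq> {}"
  obtains p and \<rho> :: "'a \<Rightarrow> nat"
  where "\<And>v. v \<in> verts T - R \<Longrightarrow> {v, p v} \<in> edges T"
    and "\<And>v. v \<in> verts T - R \<Longrightarrow> \<rho> (p v) < \<rho> v"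
proof -
  define adj where "adj = (\<lambda>x y. {x, y} \<in> edges T)"
  define reach where "reach = (\<lambda>j v. \<exists>r\<in>R. (adj ^^ j) v r)"
  define \<rho> where "\<rho> = (\<lambda>v. LEAST j. reach j v)"
  have "\<exists>w. {v, w} \<in> edges T \<and> \<rho> w < \<rho> v" if v: "v \<in> verts T - R" for v
  proof -
    obtain r where "r \<in> R" using assms(4) by blast
    with assms(2,3) v have "adj\<^sup>*\<^sup>* v r"
      by (auto simp: connected_graph_def adj_def)
    with \<open>r \<in> R\<close> have "\<exists>j. reach j v"
      unfolding reach_def by (meson rtranclp_imp_relpowp)
    then have "reach (\<rho> v) v"
      unfolding \<rho>_def by (rule LeastI_ex)
    moreover from this v have "\<rho> v \<noteq> 0"
      by (cases "\<rho> v") (auto simp: reach_def)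
    then obtain j where j: "\<rho> v = Suc j" using not0_implies_Suc by blast
    ultimately obtain r' where "r' \<in> R" "(adj ^^ Suc j) v r'"
      by (auto simp: reach_def)
    then obtain w where "adj v w" "(adj ^^ j) w r'"
      by (blast dest: relpowp_Suc_D2)
    with \<open>r' \<in> R\<close> have "reach j w" by (auto simp: reach_def)
    then have "\<rho> w \<le> j" unfolding \<rho>_def by (rule Least_le)
    with \<open>adj v w\<close> j show ?thesis by (auto simp: adj_def)
  qed
  then obtain p where "\<And>v. v \<in> verts T - R \<Longrightarrow> {v, p v} \<in> edges T \<and> \<rho> (p v) < \<rho> v"
    by metis
  then show ?thesis using that by blast
qed

lemma inj_on_parent_edge:
  fixes \<rho> :: "'a \<Rightarrow> nat"
  assumes "\<And>v. v \<in> A \<Longrightarrow> \<rho> (p v) < \<rho> v"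
  shows "inj_on (\<lambda>v. {v, p v}) A"
proof (rule inj_onI)
  fix v w assume vw: "v \<in> A" "w \<in> A" "{v, p v} = {w, p w}"
  show "v = w"
  proof (rule ccontr)
    assume "v \<noteq> w"
    with vw(3) have "p v = w" "p w = v" by (auto simp: doubleton_eq_iff)
    with assms[OF vw(1)] assms[OF vw(2)] show False by simp
  qed
qed

section \<open>Trees as connected graphs with one edge fewer than vertices\<close>

lemma connected_card_edges:
  assumes "simple_graph T" "connected_graph T"
  shows "card (verts T) \<le> card (edges T) + 1"
proof -
  obtain r where r: "r \<in> verts T" using assms(2) by (auto simp: connected_graph_def)
  then obtain p and \<rho> :: "'a \<Rightarrow> nat"
    where p: "\<And>v. v \<in> verts T - {r} \<Longrightarrow> {v, p v} \<in> edges T"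
      and \<rho>: "\<And>v. v \<in> verts T - {r} \<Longrightarrow> \<rho> (p v) < \<rho> v"
    using connected_rooted[OF assms, of "{r}"] by auto
  have "card (verts T - {r}) = card ((\<lambda>v. {v, p v}) ` (verts T - {r}))"
    using inj_on_parent_edge[of "verts T - {r}" \<rho> p, OF \<rho>] by (simp add: card_image)
  also have "\<dots> \<le> card (edges T)"
    using p finite_edges[OF assms(1)] by (intro card_mono) auto
  finally show ?thesis using r by (simp add: card_Diff_singleton)
qed

text \<open>By the count, every edge joins a vertex to its parent in a rooting. On a cycle, a vertex of maximal
  rank would have both of its distinct cycle neighbours as its parent.\<close>

lemma connected_count_imp_tree:
  assumes simple: "simple_graph T" and conn: "connected_graph T"
    and count: "card (edges T) + 1 = card (verts T)"
  shows "tree T"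
proof -
  obtain r where r: "r \<in> verts T" using conn by (auto simp: connected_graph_def)
  then obtain p and \<rho> :: "'a \<Rightarrow> nat"
    where p: "\<And>v. v \<in> verts T - {r} \<Longrightarrow> {v, p v} \<in> edges T"
      and \<rho>: "\<And>v. v \<in> verts T - {r} \<Longrightarrow> \<rho> (p v) < \<rho> v"
    using connected_rooted[OF simple conn, of "{r}"] by auto
  have E: "edges T = (\<lambda>v. {v, p v}) ` (verts T - {r})"
    using p finite_edges[OF simple] inj_on_parent_edge[of "verts T - {r}" \<rho> p, OF \<rho>] count r
    by (intro card_subset_eq[symmetric]) (auto simp: card_image card_Diff_singleton)
  have "\<not> is_cycle T c" for c
  proof
    assume c: "is_cycle T c"
    let ?n = "length c"
    have n: "3 \<le> ?n" and dist: "distinct c"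
      and edge: "\<And>i. i < ?n \<Longrightarrow> {c ! i, c ! (Suc i mod ?n)} \<in> edges T"
      using c by (auto simp: is_cycle_def)
    have "finite (set c)" "set c \<noteq> {}" using n by auto
    then have "Max (\<rho> ` set c) \<in> \<rho> ` set c" by (intro Max_in) auto
    then obtain x where "x \<in> set c" "Max (\<rho> ` set c) = \<rho> x" by auto
    then have x: "x \<in> set c" "\<And>y. y \<in> set c \<Longrightarrow> \<rho> y \<le> \<rho> x"
      by (metis List.finite_set Max_ge finite_imageI imageI)+
    then obtain i where i: "i < ?n" "x = c ! i" by (auto simp: in_set_conv_nth)
    have up: "y = p x" if xy: "{x, y} \<in> edges T" "y \<in> set c" for y
    proof -
      obtain v where "v \<in> verts T - {r}" "{x, y} = {v, p v}" using xy(1) unfolding E by blast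
      with \<rho>[of v] x(2)[OF xy(2)] show ?thesis by (auto simp: doubleton_eq_iff)
    qed
    define j where "j = (if i = 0 then ?n - 1 else i - 1)"
    have j: "j < ?n" "Suc j mod ?n = i" using n i by (auto simp: j_def)
    have "Suc i mod ?n < ?n" using n by (intro mod_less_divisor) linarith
    then have "c ! (Suc i mod ?n) = p x"
      using up[OF edge[OF i(1), folded i(2)]] by simp
    moreover have "c ! j = p x"
      using up[of "c ! j"] edge[OF j(1)] j i by (simp add: insert_commute)
    ultimately have "Suc i mod ?n = j"
      using dist j(1) n by (metis mod_less_divisor nth_eq_iff_index_eq order_less_le_trans zero_less_numeral)
    then show False using n i(1) by (cases "Suc i = ?n") (auto simp: j_def split: if_splits)
  qed
  then show ?thesis using simple conn by (simp add: tree_def)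
qed

text \<open>Trees are handled through the edge count instead of the absence of cycles, because the count
  and connectedness are what an exchange of edges visibly preserves.\<close>

definition leaf_tree :: "'a graph \<Rightarrow> 'a set \<Rightarrow> 'a graph \<Rightarrow> bool" where
  "leaf_tree G S T \<longleftrightarrow> verts T = verts G \<and> edges T \<subseteq> edges G \<and> connected_graph T \<and>
     card (edges T) + 1 = card (verts T) \<and> leaves T = S"

lemma simple_subgraph:
  "simple_graph G \<Longrightarrow> verts T = verts G \<Longrightarrow> edges T \<subseteq> edges G \<Longrightarrow> simple_graph T"
  by (auto simp: simple_graph_def)

lemma leaf_tree_spanning:
  assumes "simple_graph G" "leaf_tree G S T"
  shows "spanning_tree T G \<and> leaves T = S"
  using assms connected_count_imp_tree[of T] simple_subgraph[of G T]
  by (auto simp: leaf_tree_def spanning_tree_def)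

section \<open>Reversing a closure step\<close>

lemma joined_subst:
  assumes "joined E x y" "\<And>a b. {a, b} \<in> E \<Longrightarrow> joined E' a b"
  shows "joined E' x y"
  using assms(1) unfolding joined_def[of E]
  by (induction rule: rtranclp_induct) (auto intro: joined_trans assms(2))

lemma card_incident_insert:
  assumes "finite E" "e \<notin> E"
  shows "card {a \<in> insert e E. w \<in> a} = card {a \<in> E. w \<in> a} + of_bool (w \<in> e)"
proof -
  have "{a \<in> insert e E. w \<in> a} = (if w \<in> e then insert e {a \<in> E. w \<in> a} else {a \<in> E. w \<in> a})"
    by auto
  then show ?thesis using assms by simp
qed

lemma card_incident_insert2:
  assumes "finite E" "e \<notin> E" "e' \<notin> E" "e \<noteq> e'"
  shows "card {a \<in> insert e (insert e' E). w \<in> a} =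
    card {a \<in> E. w \<in> a} + of_bool (w \<in> e) + of_bool (w \<in> e')"
  using assms card_incident_insert[of "insert e' E" e w] card_incident_insert[of E e' w] by simp

text \<open>Otherwise the graph without the edge would still be connected, with too few edges.\<close>

lemma tree_edge_separates:
  assumes simple: "simple_graph T" and conn: "connected_graph T"
    and count: "card (edges T) + 1 = card (verts T)" and uv: "{u, v} \<in> edges T"
  shows "\<not> joined (edges T - {{u, v}}) u v"
proof
  assume uv': "joined (edges T - {{u, v}}) u v"
  let ?T = "Graph (verts T) (edges T - {{u, v}})"
  have "joined (edges ?T) a b" if "{a, b} \<in> edges T" for a b
  proof (cases "{a, b} = {u, v}")
    case True
    then show ?thesis using uv' by (auto simp: doubleton_eq_iff intro: joined_sym)
  next
    case False
    then show ?thesis using that by (auto intro: joined_edge)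
  qed
  then have "joined (edges ?T) a u" if "a \<in> verts T" for a
    using connected_graphD[OF conn that edgeD(1)[OF simple uv]] by (rule joined_subst[rotated])
  then have "connected_graph ?T"
    using edgeD(1)[OF simple uv] by (intro connected_graphI[of u]) auto
  moreover have "simple_graph ?T" using simple by (auto simp: simple_graph_def)
  ultimately have "card (verts T) \<le> card (edges T - {{u, v}}) + 1"
    using connected_card_edges[of ?T] by simp
  then show False
    using count uv finite_edges[OF simple] card_gt_0_iff[of "edges T"] by (auto simp: card_Diff_singleton)
qed

text \<open>Rooting a tree at both ends of one of its edges gives all other edges a unique lower end, so that
  the counts agree.\<close>

lemma edges_rooted_at_edge:
  fixes \<rho> :: "'a \<Rightarrow> nat"
  assumes simple: "simple_graph T" and count: "card (edges T) + 1 = card (verts T)"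
    and uv: "{u, v} \<in> edges T"
    and p: "\<And>z. z \<in> verts T - {u, v} \<Longrightarrow> {z, p z} \<in> edges T"
    and \<rho>: "\<And>z. z \<in> verts T - {u, v} \<Longrightarrow> \<rho> (p z) < \<rho> z"
  shows "edges T = insert {u, v} ((\<lambda>z. {z, p z}) ` (verts T - {u, v}))" (is "_ = insert _ ?I")
proof (rule card_subset_eq[OF finite_edges[OF simple], symmetric])
  show "insert {u, v} ?I \<subseteq> edges T" using p uv by auto
  have V: "finite (verts T)" "{u, v} \<subseteq> verts T" "u \<noteq> v"
    using simple edgeD[OF simple uv] by (auto simp: simple_graph_def)
  have "inj_on (\<lambda>z. {z, p z}) (verts T - {u, v})"
    by (rule inj_on_parent_edge[of _ \<rho>]) (rule \<rho>)
  then have "card ?I = card (verts T) - 2"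
    using V by (simp add: card_image card_Diff_subset)
  moreover have "{u, v} \<notin> ?I" by (auto simp: doubleton_eq_iff)
  moreover have "2 \<le> card (verts T)" using V card_mono[OF V(1,2)] by simp
  ultimately show "card (insert {u, v} ?I) = card (edges T)"
    using count V(1) by simp
qed

text \<open>The exchange behind the closure theorem. Removing the edges \<open>uv\<close> and \<open>x (p x)\<close>, where \<open>x\<close> lies on the
  side of \<open>u\<close>, leaves three parts: one with \<open>v\<close>, one with \<open>u\<close> and \<open>p x\<close>, one with \<open>x\<close>. The edges \<open>ux\<close>
  and \<open>v (p x)\<close> reconnect them, and each of the four vertices loses one edge and gains one, so that the
  leaves stay the same.\<close>

lemma tree_swap:
  fixes \<rho> :: "'a \<Rightarrow> nat"
  assumes simple: "simple_graph T" and conn: "connected_graph T"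
    and count: "card (edges T) + 1 = card (verts T)"
    and uv: "{u, v} \<in> edges T"
    and p: "\<And>z. z \<in> verts T - {u, v} \<Longrightarrow> {z, p z} \<in> edges T"
    and \<rho>: "\<And>z. z \<in> verts T - {u, v} \<Longrightarrow> \<rho> (p z) < \<rho> z"
    and x: "x \<in> verts T - {u, v}" "joined (edges T - {{u, v}}) x u" "p x \<noteq> u"
  defines "E' \<equiv> edges T - {{u, v}, {x, p x}} \<union> {{u, x}, {v, p x}}"
  shows "connected_graph (Graph (verts T) E')" "card E' = card (edges T)"
    "degree (Graph (verts T) E') w = degree T w"
proof -
  let ?V = "verts T"
  let ?E = "edges T"
  let ?F = "edges T - {{u, v}}"
  let ?y = "p x"
  have V: "u \<in> ?V" "v \<in> ?V" "u \<noteq> v" using edgeD[OF simple uv] by auto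
  have finE: "finite ?E" by (rule finite_edges[OF simple])
  have sep: "\<not> joined ?F u v" by (rule tree_edge_separates[OF simple conn count uv])
  have pV: "p z \<in> ?V" if "z \<in> ?V - {u, v}" for z using edgeD(2)[OF simple p[OF that]] .
  have pE0: "{z, p z} \<in> ?F" if "z \<in> ?V - {u, v}" for z
    using p[OF that] that by (auto simp: doubleton_eq_iff)
  have inj: "inj_on (\<lambda>z. {z, p z}) (?V - {u, v})" by (rule inj_on_parent_edge[of _ \<rho>]) (rule \<rho>)
  have E: "?E = insert {u, v} ((\<lambda>z. {z, p z}) ` (?V - {u, v}))"
    by (rule edges_rooted_at_edge[where \<rho> = \<rho>, OF simple count uv]) (use p \<rho> in auto)
  have xy: "joined ?F x ?y" using pE0[OF x(1)] by (rule joined_edge)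
  have yu: "joined ?F ?y u" using xy x(2) by (blast intro: joined_trans joined_sym)
  have dist: "x \<noteq> u" "x \<noteq> v" "?y \<noteq> u" "?y \<noteq> v" "x \<noteq> ?y"
    using x yu sep \<rho>[OF x(1)] by (auto dest: joined_sym)
  have f1: "{u, x} \<notin> ?E"
  proof
    assume "{u, x} \<in> ?E"
    then show False using dist V unfolding E by (auto simp: doubleton_eq_iff)
  qed
  have f2: "{v, ?y} \<notin> ?E"
  proof
    assume "{v, ?y} \<in> ?E"
    then have "{v, ?y} \<in> ?F" using dist V by (auto simp: doubleton_eq_iff)
    then have "joined ?F v ?y" by (rule joined_edge)
    with yu sep show False by (blast intro: joined_trans joined_sym)
  qed
  have keep: "{z, p z} \<in> E'" if "z \<in> ?V - {u, v}" "z \<noteq> x" for z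
  proof -
    have "{z, p z} \<noteq> {x, ?y}"
      using inj_onD[OF inj _ that(1) x(1)] that(2) by blast
    then show ?thesis using pE0[OF that(1)] by (auto simp: E'_def)
  qed
  have up: "joined E' z u" if "z \<in> ?V" "\<rho> z < \<rho> x" "joined ?F z u" for z
    using that
  proof (induction "\<rho> z" arbitrary: z rule: less_induct)
    case less
    consider "z = u" | "z = v" | "z \<in> ?V - {u, v}" using less.prems by blast
    then show ?case
    proof cases
      case 2
      then show ?thesis using less.prems sep by (auto dest: joined_sym)
    next
      case 3
      have "joined ?F (p z) u"
        using joined_edge[OF pE0[OF 3]] less.prems by (blast intro: joined_trans joined_sym)
      then have "joined E' (p z) u"
        using less.hyps[of "p z"] less.prems \<rho>[OF 3] pV[OF 3] by simp
      moreover have "joined E' z (p z)"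
        using keep[OF 3] less.prems by (blast intro: joined_edge)
      ultimately show ?thesis by (blast intro: joined_trans)
    qed simp
  qed
  have "joined E' ?y u" using up pV[OF x(1)] \<rho>[OF x(1)] yu by blast
  moreover have "joined E' v ?y" "joined E' u x" by (auto simp: E'_def intro: joined_edge)
  ultimately have uv': "joined E' u v" "joined E' x v"
    by (blast intro: joined_trans joined_sym)+
  have "joined E' z v" if "z \<in> ?V" for z
    using that
  proof (induction "\<rho> z" arbitrary: z rule: less_induct)
    case less
    consider "z = u" | "z = v" | "z = x" | "z \<in> ?V - {u, v}" "z \<noteq> x" using less.prems by blast
    then show ?case
    proof cases
      case 4
      have "joined E' (p z) v" using less.hyps[of "p z"] \<rho>[OF 4(1)] pV[OF 4(1)] by simp
      then show ?thesis using joined_edge[OF keep[OF 4]] by (blast intro: joined_trans)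
    qed (use uv' in auto)
  qed
  then show "connected_graph (Graph ?V E')"
    using V by (intro connected_graphI[of v]) auto
  let ?B = "?E - {{u, v}, {x, ?y}}"
  have finB: "finite ?B" using finE by simp
  have e12: "{u, v} \<noteq> {x, ?y}" using dist by (auto simp: doubleton_eq_iff)
  have f12: "{u, x} \<noteq> {v, ?y}" using dist V by (auto simp: doubleton_eq_iff)
  have E1: "?E = insert {u, v} (insert {x, ?y} ?B)" using uv p[OF x(1)] by auto
  have E2: "E' = insert {u, x} (insert {v, ?y} ?B)" by (auto simp: E'_def)
  have "card ?E = Suc (Suc (card ?B))" using E1 finB e12
    by (metis (no_types, lifting) Diff_iff card_insert_disjoint finite_insert insertE insertI1 insertI2)
  moreover have "card E' = Suc (Suc (card ?B))" unfolding E2 using finB f12 f1 f2 by simp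
  ultimately show "card E' = card ?E" by simp
  have "degree T w = card {a \<in> insert {u, v} (insert {x, ?y} ?B). w \<in> a}"
    unfolding degree_def by (subst E1) simp
  also have "\<dots> = card {a \<in> ?B. w \<in> a} + of_bool (w \<in> {u, v}) + of_bool (w \<in> {x, ?y})"
    using finB e12 by (intro card_incident_insert2) auto
  also have "\<dots> = card {a \<in> ?B. w \<in> a} + of_bool (w \<in> {u, x}) + of_bool (w \<in> {v, ?y})"
    using dist V by auto
  also have "\<dots> = card {a \<in> insert {u, x} (insert {v, ?y} ?B). w \<in> a}"
    using finB f12 f1 f2 by (intro card_incident_insert2[symmetric]) auto
  also have "\<dots> = degree (Graph ?V E') w"
    unfolding degree_def E2 by simp
  finally show "degree (Graph ?V E') w = degree T w" by simp
qed

text \<open>Let \<open>T\<close> be a tree that uses the extra edge \<open>uv\<close>, rooted at \<open>uv\<close>, and suppose that no exchange of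
  \<open>tree_swap\<close> yields a tree in \<open>G\<close>. Let \<open>A\<close> be the set of the neighbours of \<open>u\<close> on the side of \<open>u\<close>
  and of those of \<open>v\<close> on the side of \<open>v\<close>, and let \<open>Q\<close> consist of their parents and of \<open>u\<close>, \<open>v\<close>. No
  parent of a vertex in \<open>A\<close> is adjacent in \<open>G\<close> to the opposite end, so the remaining neighbours of \<open>u\<close> and
  \<open>v\<close> lie outside \<open>Q\<close>. Conversely \<open>Q\<close> is large: each of the nonleaves is \<open>u\<close> or \<open>v\<close> or a parent,
  hence at most \<open>card S - 2 + card Q\<close> vertices are in \<open>A\<close>. Adding up, the degrees of
  \<open>u\<close> and \<open>v\<close> sum to at most \<open>card (verts G) + card S - 2\<close>.\<close>

lemma leaf_tree_remove_edge:
  assumes simple: "simple_graph G" and uv: "u \<in> verts G" "v \<in> verts G" "u \<noteq> v" "{u, v} \<notin> edges G"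
    and T: "leaf_tree (Graph (verts G) (insert {u, v} (edges G))) S T"
    and deg: "card (verts G) + card S \<le> degree G u + degree G v + 1"
  shows "\<exists>T. leaf_tree G S T"
proof (rule ccontr)
  assume none: "\<nexists>T. leaf_tree G S T"
  let ?V = "verts G" and ?V' = "verts G - {u, v}"
  have T': "verts T = ?V" "edges T \<subseteq> insert {u, v} (edges G)" "connected_graph T"
    "card (edges T) + 1 = card (verts T)" "leaves T = S"
    using T by (auto simp: leaf_tree_def)
  have uvT: "{u, v} \<in> edges T"
  proof (rule ccontr)
    assume "{u, v} \<notin> edges T"
    with T' have "leaf_tree G S T" by (auto simp: leaf_tree_def)
    with none show False by blast
  qed
  have finV: "finite ?V" using simple by (simp add: simple_graph_def)
  have simpleT: "simple_graph T"
    by (rule simple_subgraph[of "Graph ?V (insert {u, v} (edges G))"])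
      (use simple uv T' in \<open>auto simp: simple_graph_def\<close>)
  obtain p and \<rho> :: "'a \<Rightarrow> nat"
    where p: "\<And>z. z \<in> verts T - {u, v} \<Longrightarrow> {z, p z} \<in> edges T"
      and \<rho>: "\<And>z. z \<in> verts T - {u, v} \<Longrightarrow> \<rho> (p z) < \<rho> z"
    using connected_rooted[OF simpleT T'(3), of "{u, v}"] uv T'(1) by auto
  have vuT: "{v, u} \<in> edges T" using uvT by (simp add: insert_commute)
  have p': "{z, p z} \<in> edges T" and \<rho>': "\<rho> (p z) < \<rho> z" if "z \<in> verts T - {v, u}" for z
    using p \<rho> that by auto
  have pV: "p z \<in> ?V" if "z \<in> ?V'" for z using edgeD(2)[OF simpleT p[of z]] that T'(1) by simp
  define side where "side r z = joined (edges T - {{u, v}}) z r" for r z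
  have sep: "\<not> (side u z \<and> side v z)" for z
    using tree_edge_separates[OF simpleT T'(3,4) uvT] unfolding side_def
    by (blast intro: joined_trans joined_sym)
  have side_p: "side r (p z) \<longleftrightarrow> side r z" if "z \<in> ?V'" for r z
  proof -
    have "{z, p z} \<in> edges T - {{u, v}}" using p[of z] that T'(1) by (auto simp: doubleton_eq_iff)
    then have "joined (edges T - {{u, v}}) z (p z)" by (rule joined_edge)
    then show ?thesis unfolding side_def by (blast intro: joined_trans joined_sym)
  qed
  have sides: "side u z \<or> side v z" if "z \<in> ?V" for z
    using that
  proof (induction "\<rho> z" arbitrary: z rule: less_induct)
    case less
    show ?case
    proof (cases "z \<in> ?V'")
      case True
      then show ?thesis using less.hyps[of "p z"] \<rho>[of z] T'(1) pV[OF True] side_p[OF True] by auto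
    next
      case False
      then show ?thesis using less.prems by (auto simp: side_def)
    qed
  qed
  have leaf_tree_if: "leaf_tree G S (Graph ?V E')"
    if "connected_graph (Graph (verts T) E')" "card E' = card (edges T)"
      "\<And>w. degree (Graph (verts T) E') w = degree T w" "E' \<subseteq> edges G" for E'
    using that T' by (auto simp: leaf_tree_def leaves_def)
  have noswap_u: "{v, p x} \<notin> edges G" if x: "x \<in> ?V'" "side u x" "{u, x} \<in> edges G" for x
  proof
    assume vp: "{v, p x} \<in> edges G"
    then have "p x \<noteq> u" using uv(4) by (auto simp: insert_commute)
    from x(1) T'(1) have "x \<in> verts T - {u, v}" by simp
    note * = tree_swap[where p = p and \<rho> = \<rho>, OF simpleT T'(3,4) uvT p \<rho> this x(2)[unfolded side_def] \<open>p x \<noteq> u\<close>]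
    have "edges T - {{u, v}, {x, p x}} \<union> {{u, x}, {v, p x}} \<subseteq> edges G"
      using T'(2) x(3) vp by auto
    from leaf_tree_if[OF *(1,2,3) this] none show False by blast
  qed
  have noswap_v: "{u, p x} \<notin> edges G" if x: "x \<in> ?V'" "side v x" "{v, x} \<in> edges G" for x
  proof
    assume up: "{u, p x} \<in> edges G"
    then have "p x \<noteq> v" using uv(4) by auto
    from x(1) T'(1) have xT: "x \<in> verts T - {v, u}" by auto
    have "joined (edges T - {{v, u}}) x v" using x(2) by (simp add: side_def insert_commute)
    note * = tree_swap[where p = p and \<rho> = \<rho>, OF simpleT T'(3,4) vuT p' \<rho>' xT this \<open>p x \<noteq> v\<close>]
    have "edges T - {{v, u}, {x, p x}} \<union> {{v, x}, {u, p x}} \<subseteq> edges G"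
      using T'(2) x(3) up by (auto simp: insert_commute)
    from leaf_tree_if[OF *(1,2,3) this] none show False by blast
  qed
  define Au where "Au = {z \<in> nbrs G u. side u z}"
  define Av where "Av = {z \<in> nbrs G v. side v z}"
  define Bu where "Bu = {z \<in> nbrs G u. side v z}"
  define Bv where "Bv = {z \<in> nbrs G v. side u z}"
  have N: "nbrs G u \<subseteq> ?V'" "nbrs G v \<subseteq> ?V'"
    using nbrs_subset[OF simple, of u] nbrs_subset[OF simple, of v] uv(4)
    by (auto simp: nbrs_def insert_commute)
  have fin: "finite Au" "finite Av" "finite Bu" "finite Bv"
    using finite_nbrs[OF simple] by (auto simp: Au_def Av_def Bu_def Bv_def)
  have "nbrs G u = Au \<union> Bu" "Au \<inter> Bu = {}" "nbrs G v = Av \<union> Bv" "Av \<inter> Bv = {}"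
    using sides sep N by (auto simp: Au_def Bu_def Av_def Bv_def)
  then have d: "degree G u = card Au + card Bu" "degree G v = card Av + card Bv"
    using fin by (auto simp: degree_eq_card_nbrs[OF simple] card_Un_disjoint)
  define A where "A = Au \<union> Av"
  define Q where "Q = p ` A \<union> {u, v}"
  have A: "A \<subseteq> ?V'" using N by (auto simp: A_def Au_def Av_def)
  have cA: "card A = card Au + card Av"
    unfolding A_def using sep fin by (intro card_Un_disjoint) (auto simp: Au_def Av_def)
  have QV: "Q \<subseteq> ?V" using pV A uv by (auto simp: Q_def)
  have pu: "side u (p x)" "{v, p x} \<notin> edges G" if "x \<in> Au" for x
    using that N noswap_u[of x] side_p[of x u] by (auto simp: Au_def nbrs_def)
  have pv: "side v (p x)" "{u, p x} \<notin> edges G" if "x \<in> Av" for x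
    using that N noswap_v[of x] side_p[of x v] by (auto simp: Av_def nbrs_def)
  have "Bu \<union> Bv \<subseteq> ?V - Q"
  proof -
    have "z \<notin> p ` A" if "z \<in> Bu" for z
      using that sep pu pv by (auto simp: Bu_def A_def nbrs_def)
    moreover have "z \<notin> p ` A" if "z \<in> Bv" for z
      using that sep pu pv by (auto simp: Bv_def A_def nbrs_def)
    ultimately show ?thesis using N by (auto simp: Q_def Bu_def Bv_def)
  qed
  then have "card (Bu \<union> Bv) \<le> card (?V - Q)" using finV by (intro card_mono) auto
  moreover have "card (Bu \<union> Bv) = card Bu + card Bv"
    using sep fin by (intro card_Un_disjoint) (auto simp: Bu_def Bv_def)
  ultimately have cB: "card Bu + card Bv + card Q \<le> card ?V"
    using QV card_Diff_subset[of Q ?V] card_mono[OF finV QV] finite_subset[OF QV finV] by simp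
  have "?V - S \<subseteq> Q \<union> p ` (?V' - A)"
  proof
    fix w assume w: "w \<in> ?V - S"
    show "w \<in> Q \<union> p ` (?V' - A)"
    proof (rule ccontr)
      assume no: "\<not> ?thesis"
      then have w': "w \<in> ?V'" "w \<notin> p ` ?V'" using w by (auto simp: Q_def)
      have "{e \<in> edges T. w \<in> e} = {{w, p w}}"
      proof -
        have "edges T = insert {u, v} ((\<lambda>z. {z, p z}) ` (verts T - {u, v}))"
          by (rule edges_rooted_at_edge[where \<rho> = \<rho>, OF simpleT T'(4) uvT]) (use p \<rho> in auto)
        then show ?thesis using w' p[of w] T'(1) by auto
      qed
      then have "degree T w = 1" by (simp add: degree_def)
      then show False using w T'(1,5) by (auto simp: leaves_def)
    qed
  qed
  then have "card (?V - S) \<le> card Q + card (?V' - A)"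
    using finV QV finite_subset[OF QV finV]
    by (meson card_Un_le card_image_le card_mono finite_Diff finite_UnI finite_imageI le_trans add_left_mono)
  moreover have "S \<subseteq> ?V" using T'(1,5) by (auto simp: leaves_def)
  moreover have "card (?V' - A) = card ?V' - card A"
    using A finV by (meson card_Diff_subset finite_Diff finite_subset)
  moreover have "card A \<le> card ?V'" using A finV by (intro card_mono) auto
  moreover have "card ?V' + 2 = card ?V"
    using finV uv card_mono[of ?V "{u, v}"] by (simp add: card_Diff_subset)
  moreover have "card S \<le> card ?V" "card (?V - S) = card ?V - card S"
    using finV \<open>S \<subseteq> ?V\<close> by (auto intro: card_mono simp: card_Diff_subset finite_subset)
  ultimately have "card A + 2 \<le> card Q + card S" by linarith
  then show False using cB cA d deg by linarith
qed

lemma leaf_tree_closure: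
  assumes "(closure_step l)\<^sup>*\<^sup>* G H" "simple_graph G" "card (verts G) + card S \<le> l + 1"
    "\<exists>T. leaf_tree H S T"
  shows "\<exists>T. leaf_tree G S T"
  using assms
proof (induction rule: converse_rtranclp_induct)
  case (step G G')
  have G': "simple_graph G'" "verts G' = verts G"
    using closure_step_simple_graph[OF step.hyps(1) step.prems(1)] by auto
  then have "\<exists>T. leaf_tree G' S T" using step.IH step.prems by simp
  then obtain T where T: "leaf_tree G' S T" by blast
  obtain u v where uv: "u \<in> verts G" "v \<in> verts G" "u \<noteq> v" "{u, v} \<notin> edges G"
    and d: "l \<le> degree G u + degree G v"
    and G'_eq: "G' = Graph (verts G) (insert {u, v} (edges G))"
    using step.hyps(1) unfolding closure_step_def by blast
  show ?case
    using d step.prems(2) by (intro leaf_tree_remove_edge[OF step.prems(1) uv T[unfolded G'_eq]]) simp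
qed

section \<open>Graphs whose edges have large degree sums\<close>

text \<open>Each square is at least \<open>m\<close> times the degree sum of the edge, and summing the degree sums over all
  edges counts the degree of \<open>v\<close> once for each edge at \<open>v\<close>.\<close>

lemma hyper_Zagreb_ge:
  assumes simple: "simple_graph F"
    and ore: "\<And>u v. {u, v} \<in> edges F \<Longrightarrow> m \<le> degree F u + degree F v"
  shows "m * (\<Sum>v\<in>verts F. (degree F v)\<^sup>2) \<le> hyper_Zagreb F"
proof -
  let ?d = "degree F"
  have finE: "finite (edges F)" by (rule finite_edges[OF simple])
  have finV: "finite (verts F)" using simple by (simp add: simple_graph_def)
  have "(\<Sum>v\<in>verts F. (?d v)\<^sup>2) = (\<Sum>v\<in>verts F. \<Sum>e\<in>{e \<in> edges F. v \<in> e}. ?d v)"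
    by (simp add: degree_def power2_eq_square)
  also have "\<dots> = (\<Sum>v\<in>verts F. \<Sum>e\<in>edges F. if v \<in> e then ?d v else 0)"
    using finE by (simp add: sum.inter_filter del: sum_constant)
  also have "\<dots> = (\<Sum>e\<in>edges F. \<Sum>v\<in>verts F. if v \<in> e then ?d v else 0)"
    by (rule sum.swap)
  also have "\<dots> = (\<Sum>e\<in>edges F. \<Sum>v\<in>e. ?d v)"
  proof (rule sum.cong)
    fix e assume "e \<in> edges F"
    then have "{v \<in> verts F. v \<in> e} = e" using simple by (auto simp: simple_graph_def)
    then show "(\<Sum>v\<in>verts F. if v \<in> e then ?d v else 0) = (\<Sum>v\<in>e. ?d v)"
      using finV by (simp flip: sum.inter_filter)
  qed simp
  finally have "m * (\<Sum>v\<in>verts F. (?d v)\<^sup>2) = (\<Sum>e\<in>edges F. m * (\<Sum>v\<in>e. ?d v))"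
    by (simp add: sum_distrib_left)
  also have "\<dots> \<le> (\<Sum>e\<in>edges F. (\<Sum>v\<in>e. ?d v)\<^sup>2)"
  proof (rule sum_mono)
    fix e assume e: "e \<in> edges F"
    then obtain u v where uv: "e = {u, v}" "u \<noteq> v" by (auto elim: edge_cases[OF simple])
    then have "m \<le> (\<Sum>v\<in>e. ?d v)" using ore[of u v] e by simp
    then show "m * (\<Sum>v\<in>e. ?d v) \<le> (\<Sum>v\<in>e. ?d v)\<^sup>2"
      by (simp add: power2_eq_square)
  qed
  finally show ?thesis by (simp add: hyper_Zagreb_def)
qed

lemma hyper_Zagreb_mono:
  assumes "simple_graph F" "edges F' \<subseteq> edges F"
  shows "hyper_Zagreb F' \<le> hyper_Zagreb F"
proof -
  have "degree F' v \<le> degree F v" for v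
    unfolding degree_def using assms finite_edges[OF assms(1)] by (intro card_mono) auto
  then have "hyper_Zagreb F' \<le> (\<Sum>e\<in>edges F'. (\<Sum>v\<in>e. degree F v)\<^sup>2)"
    unfolding hyper_Zagreb_def by (intro sum_mono power_mono) auto
  also have "\<dots> \<le> hyper_Zagreb F"
    unfolding hyper_Zagreb_def using assms finite_edges[OF assms(1)] by (intro sum_mono2) auto
  finally show ?thesis .
qed

text \<open>The difference of the two sides is a quadratic in \<open>d\<close> with nonnegative coefficients at \<open>d\<close> and
  \<open>d\<^sup>2\<close>, so the smallest admissible \<open>d\<close> decides: it is \<open>17 - c\<close> for \<open>c \<le> 8\<close> and \<open>c\<close> itself for larger
  \<open>c\<close>.\<close>

lemma square_sum_bound_main:
  fixes c d :: int
  assumes "3 \<le> c" "c \<le> d" "17 \<le> c + d"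
  shows "3 * (c + d)\<^sup>2 - 11 * (c + d) < c * d\<^sup>2 + (d - c + 1) * c\<^sup>2"
proof -
  define h where "h = (\<lambda>x. (c - 3) * x\<^sup>2 + (c\<^sup>2 - 6 * c + 11) * x - c ^ 3 - 2 * c\<^sup>2 + 11 * c)"
  have eq: "c * d\<^sup>2 + (d - c + 1) * c\<^sup>2 - (3 * (c + d)\<^sup>2 - 11 * (c + d)) = h d"
    by (simp add: h_def algebra_simps power2_eq_square power3_eq_cube)
  have pos: "0 \<le> c\<^sup>2 - 6 * c + 11"
    using zero_le_power2[of "c - 3"] by (simp add: power2_eq_square algebra_simps)
  have mono: "h x \<le> h d" if "0 \<le> x" "x \<le> d" for x
  proof -
    have "(c - 3) * x\<^sup>2 \<le> (c - 3) * d\<^sup>2"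
      using that assms(1) by (intro mult_left_mono power_mono) auto
    moreover have "(c\<^sup>2 - 6 * c + 11) * x \<le> (c\<^sup>2 - 6 * c + 11) * d"
      using that pos by (intro mult_left_mono) auto
    ultimately show ?thesis by (simp add: h_def)
  qed
  have "0 < h d"
  proof (cases "c \<le> 8")
    case True
    then consider "c = 3" | "c = 4" | "c = 5" | "c = 6" | "c = 7" | "c = 8" using assms(1) by linarith
    then have "0 < h (17 - c)" by cases (simp_all add: h_def)
    then show ?thesis using mono[of "17 - c"] assms True by simp
  next
    case False
    then have "0 \<le> (c - 9) * (c - 2)" by (intro mult_nonneg_nonneg) auto
    then have "0 < c * (c\<^sup>2 - 11 * c + 22)"
      using False by (intro mult_pos_pos) (auto simp: algebra_simps power2_eq_square)
    also have "\<dots> = h c" by (simp add: h_def algebra_simps power2_eq_square power3_eq_cube)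
    also have "\<dots> \<le> h d" using mono[of c] assms by simp
    finally show ?thesis .
  qed
  then show ?thesis using eq by simp
qed

text \<open>Here \<open>b\<close> vertices have degree at least \<open>d \<ge> m/2\<close>, and one of them has at least \<open>d - b + 1\<close>
  further neighbours, of degree at least \<open>m - d\<close>. The sum grows with \<open>b\<close>, so only the least admissible
  value of \<open>b\<close> matters, which is \<open>m - d\<close> unless \<open>d = m - 2\<close>.\<close>

lemma square_sum_bound:
  fixes m d b :: int
  assumes "17 \<le> m" "m \<le> 2 * d" "d \<le> m - 2" "3 \<le> b" "m - d \<le> b"
  shows "3 * m\<^sup>2 - 11 * m < b * d\<^sup>2 + (d - b + 1) * (m - d)\<^sup>2"
proof -
  define c where "c = m - d"
  have c: "m = c + d" "2 \<le> c" "c \<le> d" "17 \<le> c + d" "c \<le> b" using assms by (auto simp: c_def)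
  have sq: "c\<^sup>2 \<le> d\<^sup>2" using c by (intro power_mono) auto
  have mono: "x * d\<^sup>2 + (d - x + 1) * c\<^sup>2 \<le> b * d\<^sup>2 + (d - b + 1) * c\<^sup>2" if "x \<le> b" for x
  proof -
    have "(b - x) * c\<^sup>2 \<le> (b - x) * d\<^sup>2" using that sq by (intro mult_left_mono) auto
    then show ?thesis by (simp add: algebra_simps)
  qed
  show ?thesis
  proof (cases "c = 2")
    case True
    have "3 * m\<^sup>2 - 11 * m < 3 * d\<^sup>2 + (d - 3 + 1) * c\<^sup>2"
      using c(4) unfolding c(1) True by (simp add: algebra_simps power2_eq_square)
    then show ?thesis using mono[of 3] assms c by simp
  next
    case False
    then show ?thesis
      using square_sum_bound_main[of c d] mono[of c] c by simp
  qed
qed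

text \<open>The case in which a vertex of degree \<open>d\<close> has only neighbours of degree at least \<open>m/2\<close>, so that there
  are at least \<open>d + 1\<close> vertices of large degree.\<close>

lemma square_sum_bound_clique:
  fixes m d b :: int
  assumes "17 \<le> m" "m \<le> 2 * d" "d + 1 \<le> b"
  shows "3 * m\<^sup>2 - 11 * m < b * d\<^sup>2"
proof -
  have "m * (3 * m - 11) \<le> (2 * d) * (6 * d - 11)"
    using assms by (intro mult_mono) auto
  moreover have "0 < d * (d\<^sup>2 - 11 * d + 22)"
  proof (rule mult_pos_pos)
    have "0 \<le> (d - 9) * (d - 2)" using assms by (intro mult_nonneg_nonneg) auto
    then show "0 < d\<^sup>2 - 11 * d + 22" by (simp add: algebra_simps power2_eq_square)
  qed (use assms in auto)
  moreover have "(d + 1) * d\<^sup>2 \<le> b * d\<^sup>2" using assms by (intro mult_right_mono) auto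
  ultimately show ?thesis by (simp add: algebra_simps power2_eq_square power3_eq_cube)
qed

text \<open>Let \<open>L\<close> be the set of vertices of degree at least \<open>m/2\<close>; it meets every edge, so a vertex outside \<open>L\<close>
  has all its neighbours in \<open>L\<close>. Let \<open>y\<close> have the least degree \<open>d\<close> in \<open>L\<close>. If \<open>y\<close> has a neighbour outside
  \<open>L\<close>, this neighbour has degree at least \<open>m - d\<close>, so \<open>L\<close> has at least \<open>m - d\<close> elements; otherwise
  \<open>L\<close> has more than \<open>d\<close> elements. In view of the bound on the sum of squares this leaves only \<open>card L = 2\<close> and \<open>d = m - 2\<close>. Every vertex outside \<open>L\<close> that has an edge then has
  degree at least 2, hence is adjacent to both elements of \<open>L\<close>.\<close>

lemma sparse_complement_structure:
  assumes simple: "simple_graph F" and m: "17 \<le> m"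
    and ore: "\<And>u v. {u, v} \<in> edges F \<Longrightarrow> m \<le> degree F u + degree F v"
    and max: "\<And>v. v \<in> verts F \<Longrightarrow> degree F v \<le> m - 2"
    and sum: "int (\<Sum>v\<in>verts F. (degree F v)\<^sup>2) \<le> 3 * (int m)\<^sup>2 - 11 * int m"
    and nonempty: "edges F \<noteq> {}"
  obtains y1 y2 Z where "y1 \<noteq> y2" "y1 \<in> verts F" "y2 \<in> verts F" "Z \<subseteq> verts F - {y1, y2}"
    "card Z = (if {y1, y2} \<in> edges F then m - 3 else m - 2)"
    "edges F - {{y1, y2}} = {{y, z} |y z. y \<in> {y1, y2} \<and> z \<in> Z}"
proof -
  let ?d = "degree F" and ?V = "verts F"
  have finV: "finite ?V" using simple by (simp add: simple_graph_def)
  define L where "L = {v \<in> ?V. m \<le> 2 * ?d v}"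
  define b where "b = card L"
  have finL: "finite L" using finV by (simp add: L_def)
  have cover: "v \<in> L" if "{u, v} \<in> edges F" "u \<notin> L" for u v
  proof -
    have "u \<in> ?V" "v \<in> ?V" using edgeD[OF simple that(1)] by auto
    then show ?thesis using ore[OF that(1)] that(2) by (auto simp: L_def)
  qed
  have small: "nbrs F z \<subseteq> L" if "z \<notin> L" for z
    using cover that by (auto simp: nbrs_def)
  have "L \<noteq> {}"
  proof -
    obtain e where "e \<in> edges F" using nonempty by blast
    then obtain u v where "{u, v} \<in> edges F" using edge_cases[OF simple] by metis
    then show ?thesis using cover by blast
  qed
  then obtain y where y: "y \<in> L" and ymin: "\<And>v. v \<in> L \<Longrightarrow> ?d y \<le> ?d v"
    using ex_is_arg_min_if_finite[OF finL, of ?d] by (auto simp: is_arg_min_linorder)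
  define d where "d = ?d y"
  have d: "m \<le> 2 * d" "d \<le> m - 2" using y max by (auto simp: d_def L_def)
  have sumL: "b * d\<^sup>2 \<le> (\<Sum>v\<in>L. (?d v)\<^sup>2)"
    unfolding b_def using sum_bounded_below[of L "d\<^sup>2" "\<lambda>v. (?d v)\<^sup>2"] ymin
    by (auto simp: d_def power_mono)
  have dN: "d = card (nbrs F y)" unfolding d_def by (rule degree_eq_card_nbrs[OF simple])
  have NL: "nbrs F y \<inter> L \<subseteq> L - {y}" using nbrs_subset[OF simple, of y] by auto
  then have cNL: "card (nbrs F y \<inter> L) \<le> b - 1"
    using finL y card_mono[of "L - {y}" "nbrs F y \<inter> L"] by (simp add: b_def)
  have b_pos: "1 \<le> b" using finL y by (auto simp: b_def Suc_le_eq card_gt_0_iff)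
  have b_le: "int b * (int d)\<^sup>2 \<le> 3 * (int m)\<^sup>2 - 11 * int m"
  proof -
    have "(\<Sum>v\<in>L. (?d v)\<^sup>2) \<le> (\<Sum>v\<in>?V. (?d v)\<^sup>2)"
      using finV by (intro sum_mono2) (auto simp: L_def)
    with sumL have "b * d\<^sup>2 \<le> (\<Sum>v\<in>?V. (?d v)\<^sup>2)" by linarith
    then have "int (b * d\<^sup>2) \<le> int (\<Sum>v\<in>?V. (?d v)\<^sup>2)" by linarith
    then show ?thesis using sum by simp
  qed
  have "\<not> nbrs F y \<subseteq> L"
  proof
    assume "nbrs F y \<subseteq> L"
    then have "d \<le> b - 1" using cNL dN by (simp add: Int_absorb2)
    then have "int d + 1 \<le> int b" using b_pos by linarith
    then show False
      using square_sum_bound_clique[of "int m" "int d" "int b"] b_le m d by simp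
  qed
  then obtain z0 where z0: "z0 \<in> nbrs F y" "z0 \<notin> L" by blast
  have dz: "m - d \<le> ?d z" if "z \<in> nbrs F y" for z
    using ore[of y z] that by (simp add: nbrs_def d_def)
  have "?d z0 \<le> b"
    unfolding b_def degree_eq_card_nbrs[OF simple] by (rule card_mono[OF finL small[OF z0(2)]])
  then have b_ge: "m - d \<le> b" using dz[OF z0(1)] by simp
  have "b < 3"
  proof (rule ccontr)
    assume "\<not> b < 3"
    let ?M = "nbrs F y - L"
    have finN: "finite (nbrs F y)" by (rule finite_nbrs[OF simple])
    have "card ?M * (m - d)\<^sup>2 \<le> (\<Sum>v\<in>?M. (?d v)\<^sup>2)"
      using sum_bounded_below[of ?M "(m - d)\<^sup>2" "\<lambda>v. (?d v)\<^sup>2"] dz by (auto simp: power_mono)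
    then have "b * d\<^sup>2 + card ?M * (m - d)\<^sup>2 \<le> (\<Sum>v\<in>L \<union> ?M. (?d v)\<^sup>2)"
      using sumL finL finN by (subst sum.union_disjoint) auto
    also have "\<dots> \<le> (\<Sum>v\<in>?V. (?d v)\<^sup>2)"
      using finV nbrs_subset[OF simple, of y] by (intro sum_mono2) (auto simp: L_def)
    finally have "int (b * d\<^sup>2 + card ?M * (m - d)\<^sup>2) \<le> 3 * (int m)\<^sup>2 - 11 * int m"
      using sum by linarith
    then have up: "int b * (int d)\<^sup>2 + int (card ?M) * (int m - int d)\<^sup>2 \<le> 3 * (int m)\<^sup>2 - 11 * int m"
      using d by (simp add: of_nat_diff)
    have "card ?M = d - card (nbrs F y \<inter> L)"
      using finN unfolding dN by (metis Diff_Int_distrib card_Diff_subset_Int finite_Int)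
    then have "int d - int b + 1 \<le> int (card ?M)" using cNL b_pos by linarith
    then have "(int d - int b + 1) * (int m - int d)\<^sup>2 \<le> int (card ?M) * (int m - int d)\<^sup>2"
      by (intro mult_right_mono) auto
    then show False
      using up square_sum_bound[of "int m" "int d" "int b"] m d b_ge \<open>\<not> b < 3\<close> by linarith
  qed
  then have b2: "b = 2" "d = m - 2" using b_ge d m by linarith+
  then obtain y1 y2 where L: "L = {y1, y2}" "y1 \<noteq> y2"
    unfolding b_def by (auto simp: card_2_iff)
  have yV: "y1 \<in> ?V" "y2 \<in> ?V" using L by (auto simp: L_def)
  have dL: "?d v = m - 2" if "v \<in> L" for v
    using ymin[OF that] max[of v] that b2 by (auto simp: d_def L_def)
  have both: "nbrs F z = L" if z: "z \<notin> L" "{y', z} \<in> edges F" for y' z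
  proof (rule card_subset_eq[OF finL small[OF z(1)]])
    have "y' \<in> L" using cover[of z y'] z by (simp add: insert_commute)
    then have "2 \<le> ?d z" using ore[OF z(2)] dL m by simp
    moreover have "card (nbrs F z) \<le> b"
      unfolding b_def by (rule card_mono[OF finL small[OF z(1)]])
    ultimately show "card (nbrs F z) = card L"
      using b2 by (simp add: degree_eq_card_nbrs[OF simple] b_def)
  qed
  define Z where "Z = nbrs F y1 - L"
  have Z: "z \<in> Z \<longleftrightarrow> z \<notin> L \<and> {y', z} \<in> edges F" if "y' \<in> L" for y' z
  proof -
    have "{y1, z} \<in> edges F \<longleftrightarrow> {y', z} \<in> edges F" if "z \<notin> L"
      using both[OF that, of y1] both[OF that, of y'] L \<open>y' \<in> L\<close>
      by (auto simp: nbrs_def insert_commute)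
    then show ?thesis by (auto simp: Z_def nbrs_def)
  qed
  have "nbrs F y1 = Z \<union> (if {y1, y2} \<in> edges F then {y2} else {})"
    using L(1) nbrs_subset[OF simple, of y1] by (auto simp: Z_def nbrs_def)
  moreover have "finite Z" unfolding Z_def using finite_nbrs[OF simple] by simp
  moreover have "y2 \<notin> Z" using L by (auto simp: Z_def)
  moreover have "card (nbrs F y1) = m - 2" using dL[of y1] L by (simp add: degree_eq_card_nbrs[OF simple])
  ultimately have cZ: "card Z = (if {y1, y2} \<in> edges F then m - 3 else m - 2)"
    by (auto split: if_splits)
  have "edges F - {{y1, y2}} = {{y, z} |y z. y \<in> {y1, y2} \<and> z \<in> Z}"
  proof (intro equalityI subsetI)
    fix e assume e: "e \<in> edges F - {{y1, y2}}"
    then obtain u v where uv: "e = {u, v}" "u \<noteq> v" using edge_cases[OF simple] by (metis DiffD1)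
    have uv_in: "u \<in> L \<or> v \<in> L" "\<not> (u \<in> L \<and> v \<in> L)"
      using cover[of u v] e uv L by auto
    then consider "u \<in> L" "v \<notin> L" | "v \<in> L" "u \<notin> L" by blast
    then show "e \<in> {{y, z} |y z. y \<in> {y1, y2} \<and> z \<in> Z}"
    proof cases
      case 1
      then show ?thesis using Z[of u v] e uv L by auto
    next
      case 2
      then have "u \<in> Z" using Z[of v u] e uv by (simp add: insert_commute)
      moreover have "e = {v, u}" using uv by auto
      ultimately show ?thesis using 2 L by blast
    qed
  next
    fix e assume "e \<in> {{y, z} |y z. y \<in> {y1, y2} \<and> z \<in> Z}"
    then obtain y' z where "e = {y', z}" "y' \<in> L" "z \<in> Z" using L by auto
    then show "e \<in> edges F - {{y1, y2}}" using Z[of y' z] L by (auto simp: doubleton_eq_iff)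
  qed
  moreover have "Z \<subseteq> ?V - {y1, y2}" using L nbrs_subset[OF simple, of y1] by (auto simp: Z_def)
  ultimately show thesis using that[of y1 y2 Z] L(2) yV cZ by blast
qed

section \<open>Growing trees with prescribed leaves\<close>

text \<open>Of a tree that is built by attaching leaves one at a time, only the vertex set \<open>V\<close> and the leaf set
  \<open>S\<close> are recorded, which makes explicit constructions a matter of sets: attaching \<open>v\<close> to \<open>w\<close> makes \<open>v\<close> a
  leaf, and \<open>w\<close> no longer is one.\<close>

inductive grown :: "'a set set \<Rightarrow> 'a set \<Rightarrow> 'a set \<Rightarrow> bool" for E where
  edge: "{a, b} \<in> E \<Longrightarrow> a \<noteq> b \<Longrightarrow> grown E {a, b} {a, b}"
| attach: "grown E V S \<Longrightarrow> w \<in> V \<Longrightarrow> v \<notin> V \<Longrightarrow> {w, v} \<in> E \<Longrightarrow>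
    grown E (insert v V) (insert v (S - {w}))"

lemma grown_tree:
  assumes "grown E V S"
  shows "\<exists>E'\<subseteq>E. simple_graph (Graph V E') \<and> connected_graph (Graph V E') \<and>
    card E' + 1 = card V \<and> 2 \<le> card V \<and> leaves (Graph V E') = S"
  using assms
proof induction
  case (edge a b)
  let ?T = "Graph {a, b} {{a, b}}"
  have "{e \<in> edges ?T. a \<in> e} = {{a, b}}" "{e \<in> edges ?T. b \<in> e} = {{a, b}}" by auto
  then have "degree ?T a = 1" "degree ?T b = 1" by (simp_all add: degree_def)
  then have "leaves ?T = {a, b}" by (auto simp: leaves_def)
  moreover have "connected_graph ?T"
    by (rule connected_graphI[of a]) (auto intro: joined_edge simp: insert_commute)
  ultimately show ?case using edge by (intro exI[of _ "{{a, b}}"]) (auto simp: simple_graph_def)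
next
  case (attach V S w v)
  have wv: "w \<in> V" "v \<notin> V" "w \<noteq> v" "{w, v} \<in> E" using attach.hyps by auto
  obtain E' where E': "E' \<subseteq> E" "simple_graph (Graph V E')" "connected_graph (Graph V E')"
    "card E' + 1 = card V" "2 \<le> card V" "leaves (Graph V E') = S"
    using attach.IH by blast
  let ?T = "Graph V E'" and ?E = "insert {w, v} E'"
  let ?T' = "Graph (insert v V) ?E"
  have fin: "finite V" "finite E'" using E'(2) finite_edges[OF E'(2)] by (auto simp: simple_graph_def)
  have out: "{e \<in> E'. v \<in> e} = {}" using E'(2) wv by (auto simp: simple_graph_def)
  then have new: "{w, v} \<notin> E'" by auto
  have deg: "degree ?T' z = degree ?T z + of_bool (z = w \<or> z = v)" for z
    using card_incident_insert[OF fin(2) new, of z] by (simp add: degree_def)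
  have deg_v: "degree ?T v = 0" by (simp only: degree_def graph.sel out card.empty)
  have "\<exists>x. {w, x} \<in> E'"
  proof -
    have "card {w} < card V" using E'(5) by simp
    then obtain r where "r \<in> V" "r \<noteq> w"
      by (metis card_mono finite.emptyI finite_insert leD singletonI subsetI)
    moreover have "joined E' w r"
      using connected_graphD[OF E'(3), of w r] \<open>r \<in> V\<close> wv by simp
    ultimately show ?thesis
      unfolding joined_def by (auto elim: converse_rtranclpE)
  qed
  then obtain x where "{w, x} \<in> E'" by blast
  then have "{w, x} \<in> {e \<in> E'. w \<in> e}" by simp
  then have deg_w: "degree ?T w \<noteq> 0" using fin by (auto simp: degree_def)
  have "leaves ?T' = insert v (leaves ?T - {w})"
    using deg deg_v deg_w wv by (auto simp: leaves_def split: if_splits)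
  moreover have "simple_graph ?T'" using E'(2) wv by (auto simp: simple_graph_def)
  moreover have "connected_graph ?T'"
  proof (rule connected_graphI[of w])
    fix z assume "z \<in> verts ?T'"
    moreover have "joined ?E z w" if "z \<in> V"
      using connected_graphD[OF E'(3), of z w] that wv by (auto intro: joined_mono)
    moreover have "joined ?E v w" by (rule joined_edge) (simp add: insert_commute)
    ultimately show "joined (edges ?T') z w" by auto
  qed (use wv in auto)
  moreover have "card ?E + 1 = card (insert v V)" using fin new wv E'(4) by simp
  ultimately show ?case
    using E' wv fin by (intro exI[of _ ?E]) auto
qed

lemma grown_leaf_tree:
  assumes "grown (edges G) (verts G) S"
  shows "\<exists>T. leaf_tree G S T"
proof -
  obtain E' where "E' \<subseteq> edges G" "connected_graph (Graph (verts G) E')"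
    "card E' + 1 = card (verts G)" "leaves (Graph (verts G) E') = S"
    using grown_tree[OF assms] by blast
  then have "leaf_tree G S (Graph (verts G) E')" by (simp add: leaf_tree_def)
  then show ?thesis by blast
qed

lemma grown_path:
  assumes "successively (\<lambda>x y. {x, y} \<in> E) xs" "distinct xs" "2 \<le> length xs"
  shows "grown E (set xs) {hd xs, last xs}"
  using assms
proof (induction xs rule: induct_list012)
  case (3 x y zs)
  show ?case
  proof (cases "zs = []")
    case True
    then show ?thesis using 3 grown.edge[of x y E] by simp
  next
    case False
    then have "grown E (set (y # zs)) {y, last zs}" using 3 by (cases zs) auto
    then have "grown E (insert x (set (y # zs))) (insert x ({y, last zs} - {y}))"
      using 3 by (intro grown.attach) (auto simp: insert_commute)
    moreover have "{y, last zs} - {y} = {last zs}" using 3 False by auto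
    ultimately show ?thesis using False by simp
  qed
qed auto

lemma grown_attach_all:
  assumes "grown E V S" "finite A" "A \<inter> V = {}" "\<And>a. a \<in> A \<Longrightarrow> \<exists>w\<in>V - S. {w, a} \<in> E"
  shows "grown E (V \<union> A) (S \<union> A)"
  using assms(2-4)
proof (induction A rule: finite_induct)
  case empty
  then show ?case using assms(1) by simp
next
  case (insert a A)
  then obtain w where w: "w \<in> V - S" "{w, a} \<in> E" by auto
  have "grown E (insert a (V \<union> A)) (insert a ((S \<union> A) - {w}))"
    using insert w by (intro grown.attach) auto
  moreover have "(S \<union> A) - {w} = S \<union> A" using w insert by auto
  ultimately show ?case by simp
qed

text \<open>A Hamiltonian path of the graph without \<open>S\<close>, prolonged at both ends into \<open>S\<close>, has
  no leaves outside \<open>S\<close>; the rest of \<open>S\<close> can be attached anywhere on the path.\<close>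

lemma leaf_tree_of_path:
  assumes "finite S" "S \<subseteq> verts G"
    and ws: "distinct ws" "set ws = verts G - S" "ws \<noteq> []"
      "successively (\<lambda>x y. {x, y} \<in> edges G) ws"
    and s: "s1 \<in> S" "s2 \<in> S" "s1 \<noteq> s2" "{s1, hd ws} \<in> edges G" "{last ws, s2} \<in> edges G"
    and rest: "\<And>a. a \<in> S \<Longrightarrow> \<exists>w\<in>verts G - S. {w, a} \<in> edges G"
  shows "\<exists>T. leaf_tree G S T"
proof -
  let ?E = "edges G" and ?xs = "s1 # ws @ [s2]"
  have "successively (\<lambda>x y. {x, y} \<in> ?E) ?xs"
    using ws s by (auto simp: successively_Cons successively_append_iff)
  moreover have "distinct ?xs" using ws s by auto
  ultimately have "grown ?E (set ?xs) {s1, s2}"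
    using grown_path[of ?E ?xs] by simp
  then have "grown ?E (set ?xs \<union> (S - {s1, s2})) ({s1, s2} \<union> (S - {s1, s2}))"
    using assms by (intro grown_attach_all) auto
  moreover have "set ?xs \<union> (S - {s1, s2}) = verts G" "{s1, s2} \<union> (S - {s1, s2}) = S"
    using assms by auto
  ultimately show ?thesis using grown_leaf_tree[of G S] by simp
qed

lemma successively_clique:
  assumes "distinct ws" "\<And>x y. x \<in> set ws \<Longrightarrow> y \<in> set ws \<Longrightarrow> x \<noteq> y \<Longrightarrow> P x y"
  shows "successively P ws"
  using assms by (induction ws rule: induct_list012) auto

lemma complete_leaf_tree:
  assumes simple: "simple_graph G"
    and complete: "\<And>a b. a \<in> verts G \<Longrightarrow> b \<in> verts G \<Longrightarrow> a \<noteq> b \<Longrightarrow> {a, b} \<in> edges G"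
    and S: "S \<subseteq> verts G" "S \<noteq> verts G" "2 \<le> card S"
  shows "\<exists>T. leaf_tree G S T"
proof -
  have fin: "finite (verts G)" using simple by (simp add: simple_graph_def)
  then obtain ws where ws: "set ws = verts G - S" "distinct ws"
    using finite_distinct_list[of "verts G - S"] by auto
  obtain s1 s2 where s: "s1 \<in> S" "s2 \<in> S" "s1 \<noteq> s2"
    using S(3) card_le_Suc0_iff_eq[of S] finite_subset[OF S(1) fin] by fastforce
  have "ws \<noteq> []" using ws S by auto
  then have ends: "hd ws \<in> verts G - S" "last ws \<in> verts G - S"
    using hd_in_set[of ws] last_in_set[of ws] unfolding ws(1) by auto
  show ?thesis
  proof (rule leaf_tree_of_path[OF finite_subset[OF S(1) fin] S(1) ws(2,1) \<open>ws \<noteq> []\<close> _ s])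
    show "successively (\<lambda>x y. {x, y} \<in> edges G) ws"
      using ws complete by (intro successively_clique) auto
    show "{s1, hd ws} \<in> edges G" "{last ws, s2} \<in> edges G"
      using ends s S(1) by (auto intro!: complete)
    show "\<exists>w\<in>verts G - S. {w, a} \<in> edges G" if "a \<in> S" for a
      using ends that S(1) by (intro bexI[of _ "hd ws"] complete) auto
  qed
qed

text \<open>The vertices of \<open>U\<close> are universal, and there is one more of them than leaves are wanted; only
  \<open>y1\<close> and \<open>y2\<close> may be nonadjacent to each other and to vertices of \<open>Z\<close>. If \<open>S\<close> misses at least two
  vertices \<open>c1\<close>, \<open>c2\<close> of \<open>U\<close>, these link whichever of \<open>y1\<close> and \<open>y2\<close> are outside \<open>S\<close> into a Hamiltonian
  path of \<open>G\<close> without \<open>S\<close>. If \<open>S\<close> lies in \<open>U\<close>, only one vertex \<open>c\<close> of \<open>U\<close> remains, and the tree branches at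
  \<open>c\<close> into three arms, through \<open>y1\<close>, through \<open>y2\<close> and through \<open>Z\<close>, each ending in a leaf of its own:
  this takes three leaves.\<close>

lemma twins_leaf_tree:
  assumes simple: "simple_graph G"
    and V: "verts G = U \<union> Z \<union> {y1, y2}" "U \<inter> Z = {}" "y1 \<notin> U \<union> Z" "y2 \<notin> U \<union> Z" "y1 \<noteq> y2"
    and adj: "\<And>a b. a \<in> verts G \<Longrightarrow> b \<in> verts G \<Longrightarrow> a \<noteq> b \<Longrightarrow>
      a \<in> U \<or> b \<in> U \<or> a \<in> Z \<and> b \<in> Z \<Longrightarrow> {a, b} \<in> edges G"
    and S: "S \<subseteq> verts G" "3 \<le> card S" and U: "card U = card S + 1" and Z: "Z \<noteq> {}"
  shows "\<exists>T. leaf_tree G S T"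
proof -
  let ?E = "edges G"
  let ?adj = "\<lambda>x y. {x, y} \<in> ?E"
  have fin: "finite U" "finite Z" "finite S"
    using simple finite_subset[OF S(1)] V by (auto simp: simple_graph_def)
  have core: "{a, b} \<in> ?E" if "a \<in> U \<union> Z" "b \<in> U \<union> Z" "a \<noteq> b" for a b
    using that V(1) by (intro adj) auto
  show ?thesis
  proof (cases "S \<subseteq> U")
    case True
    then have "card (U - S) = 1" using U fin by (simp add: card_Diff_subset)
    then obtain c where c: "U - S = {c}" by (auto simp: card_1_singleton_iff)
    obtain A where "A \<subseteq> S" "card A = 3"
      by (rule obtain_subset_with_card_n[OF S(2)])
    then obtain s1 s2 s3 where s: "{s1, s2, s3} \<subseteq> S" "s1 \<noteq> s2" "s1 \<noteq> s3" "s2 \<noteq> s3"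
      by (auto simp: card_3_iff)
    obtain zs where zs: "set zs = Z" "distinct zs" using finite_distinct_list[OF fin(2)] by blast
    have zs': "zs \<noteq> []" "hd zs \<in> Z" "last zs \<in> Z"
      using zs Z hd_in_set[of zs] last_in_set[of zs] by auto
    have cU: "c \<in> U" "c \<notin> S" "c \<in> verts G" using c V by auto
    have sU: "s1 \<in> U" "s2 \<in> U" "s3 \<in> U" using s True by auto
    let ?xs = "s1 # y1 # c # zs @ [s3]"
    have "successively ?adj zs" using zs core by (intro successively_clique) auto
    then have "successively ?adj ?xs"
      using zs' V cU sU by (auto simp: successively_Cons successively_append_iff
          intro!: adj)
    moreover have "distinct ?xs" using zs V s sU cU by auto
    ultimately have "grown ?E (set ?xs) {s1, s3}" using grown_path[of ?E ?xs] by simp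
    \<comment> \<open>the third arm: first \<open>y2\<close> at \<open>c\<close>, then the leaf \<open>s2\<close> at \<open>y2\<close>\<close>
    then have "grown ?E (insert y2 (set ?xs)) (insert y2 ({s1, s3} - {c}))"
      by (rule grown.attach) (use V zs cU sU in \<open>auto intro!: adj\<close>)
    then have "grown ?E (insert s2 (insert y2 (set ?xs)))
        (insert s2 (insert y2 ({s1, s3} - {c}) - {y2}))"
      by (rule grown.attach) (use V zs cU sU s in \<open>auto intro!: adj\<close>)
    moreover have "insert s2 (insert y2 ({s1, s3} - {c}) - {y2}) = {s1, s2, s3}"
      using V s cU sU by auto
    ultimately have "grown ?E (insert s2 (insert y2 (set ?xs))) {s1, s2, s3}" by simp
    then have "grown ?E (insert s2 (insert y2 (set ?xs)) \<union> (S - {s1, s2, s3}))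
        ({s1, s2, s3} \<union> (S - {s1, s2, s3}))"
    proof (rule grown_attach_all)
      show "(S - {s1, s2, s3}) \<inter> insert s2 (insert y2 (set ?xs)) = {}"
        using V zs cU True by auto
      show "\<exists>w\<in>insert s2 (insert y2 (set ?xs)) - {s1, s2, s3}. {w, a} \<in> ?E"
        if "a \<in> S - {s1, s2, s3}" for a
        using that cU s S(1) by (intro bexI[of _ c] adj) auto
    qed (use fin in auto)
    moreover have "insert s2 (insert y2 (set ?xs)) \<union> (S - {s1, s2, s3}) = verts G"
      using V zs c s True by auto
    moreover have "{s1, s2, s3} \<union> (S - {s1, s2, s3}) = S" using s by auto
    ultimately show ?thesis using grown_leaf_tree[of G S] by simp
  next
    case False
    have "card (U \<inter> S) < card S" using False fin by (intro psubset_card_mono) auto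
    then have "2 \<le> card (U - S)" using U fin by (simp add: card_Diff_subset_Int)
    then obtain C where "C \<subseteq> U - S" "card C = 2" by (rule obtain_subset_with_card_n)
    then obtain c1 c2 where c: "c1 \<in> U - S" "c2 \<in> U - S" "c1 \<noteq> c2" by (auto simp: card_2_iff)
    have cV: "c1 \<in> verts G" "c2 \<in> verts G" using c V by auto
    have via_path: ?thesis
      if "distinct ws" "set ws = verts G - S" "successively ?adj ws"
        "s1 \<in> S" "s2 \<in> S" "s1 \<noteq> s2" "{s1, hd ws} \<in> ?E" "{last ws, s2} \<in> ?E" for ws s1 s2
    proof (rule leaf_tree_of_path[OF fin(3) S(1) that(1,2) _ that(3-8)])
      show "ws \<noteq> []" using that(2) c cV by auto
      show "\<exists>w\<in>verts G - S. {w, a} \<in> ?E" if "a \<in> S" for a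
        using that c cV S(1) by (intro bexI[of _ c1] adj) auto
    qed
    obtain rs where rs: "set rs = (U \<union> Z) - S - {c1, c2}" "distinct rs"
      using finite_distinct_list[of "(U \<union> Z) - S - {c1, c2}"] fin by auto
    have rs_path: "successively ?adj (c2 # rs)"
      using rs c by (intro successively_clique core) auto
    have last_clique: "last (c2 # xs) \<in> U \<union> Z - S" if "set xs \<subseteq> U \<union> Z - S" for xs
    proof -
      have "last (c2 # xs) \<in> set (c2 # xs)" by (rule last_in_set) simp
      also have "\<dots> \<subseteq> U \<union> Z - S" using that c by auto
      finally show ?thesis .
    qed
    have last_rs: "last (c2 # rs) \<in> U \<union> Z - S" using rs by (intro last_clique) auto
    have one_twin: ?thesis if y: "ya \<in> S" "{ya, yb} = {y1, y2}" for ya yb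
    proof -
      have yy: "ya \<noteq> yb" "ya \<notin> U \<union> Z" "yb \<notin> U \<union> Z" "yb \<in> verts G" "verts G = U \<union> Z \<union> {ya, yb}"
        using y V by (auto simp: doubleton_eq_iff)
      have "card {ya, yb} < card S" using S(2) yy by simp
      then have "\<not> S \<subseteq> {ya, yb}" by (meson card_mono finite.intros leD)
      then obtain s where s: "s \<in> S" "s \<noteq> ya" "s \<noteq> yb" by blast
      then have sUZ: "s \<in> U \<union> Z" using S(1) yy by auto
      have last: "{last (c2 # rs), s} \<in> ?E" using last_rs sUZ s by (intro core) auto
      show ?thesis
      proof (cases "yb \<in> S")
        case True
        show ?thesis
        proof (rule via_path[of "c1 # c2 # rs" ya s])
          show "set (c1 # c2 # rs) = verts G - S" using rs c yy y True by auto
        qed (use rs rs_path c cV y yy s last S(1) in \<open>auto intro!: adj\<close>)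
      next
        case False
        show ?thesis
        proof (rule via_path[of "c1 # yb # c2 # rs" ya s])
          show "set (c1 # yb # c2 # rs) = verts G - S" using rs c yy y False by auto
          show "successively ?adj (c1 # yb # c2 # rs)"
            using rs_path c yy by (auto intro!: adj)
        qed (use rs c y yy s last S(1) in \<open>auto intro!: adj\<close>)
      qed
    qed
    show ?thesis
    proof (cases "y1 \<in> S \<or> y2 \<in> S")
      case True
      then show ?thesis using one_twin[of y1 y2] one_twin[of y2 y1] by (auto simp: insert_commute)
    next
      case False
      have SUZ: "S \<subseteq> U \<union> Z" using S(1) V(1) False by auto
      have two: "\<exists>s'\<in>S. s' \<noteq> s" for s
      proof -
        have "card {s} < card S" using S(2) by simp
        then show ?thesis by (metis card_mono finite.emptyI finite_insert leD singletonI subsetI)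
      qed
      show ?thesis
      proof (cases "S \<inter> U = {}")
        case disj: True
        \<comment> \<open>\<open>y1\<close> may have no neighbour in \<open>S\<close>, so the path starts in a third universal vertex\<close>
        have "card {c1, c2} < card U" using U S(2) c by simp
        then obtain c0 where c0: "c0 \<in> U" "c0 \<noteq> c1" "c0 \<noteq> c2"
          by (metis card_mono finite.emptyI finite_insert insert_iff leD subsetI)
        obtain s1 where s1: "s1 \<in> S" using two by blast
        obtain s2 where s2: "s2 \<in> S" "s2 \<noteq> s1" using two by blast
        obtain qs where qs: "set qs = (U \<union> Z) - S - {c0, c1, c2}" "distinct qs"
          using finite_distinct_list[of "(U \<union> Z) - S - {c0, c1, c2}"] fin by auto
        have qs_path: "successively ?adj (c2 # qs)"
          using qs c by (intro successively_clique core) auto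
        have "last (c2 # qs) \<in> U \<union> Z - S" using qs by (intro last_clique) auto
        then have last: "{last (c2 # qs), s2} \<in> ?E" using s2 SUZ by (intro core) auto
        have c0S: "c0 \<notin> S" using disj c0 by auto
        show ?thesis
        proof (rule via_path[of "c0 # y1 # c1 # y2 # c2 # qs" s1 s2])
          show "set (c0 # y1 # c1 # y2 # c2 # qs) = verts G - S"
            using qs c c0 c0S V(1) False by auto
          show "successively ?adj (c0 # y1 # c1 # y2 # c2 # qs)"
            using qs_path c c0 V by (auto intro!: adj)
          show "distinct (c0 # y1 # c1 # y2 # c2 # qs)" using qs c c0 V by auto
          show "{s1, hd (c0 # y1 # c1 # y2 # c2 # qs)} \<in> ?E"
            using s1 c0 c0S S(1) V(1) by (auto intro!: adj)
        qed (use s1 s2 last in auto)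
      next
        case meet: False
        then obtain s1 where s1: "s1 \<in> S" "s1 \<in> U" by blast
        obtain s2 where s2: "s2 \<in> S" "s2 \<noteq> s1" using two by blast
        have last: "{last (c2 # rs), s2} \<in> ?E" using last_rs s2 SUZ by (intro core) auto
        show ?thesis
        proof (rule via_path[of "y1 # c1 # y2 # c2 # rs" s1 s2])
          show "set (y1 # c1 # y2 # c2 # rs) = verts G - S" using rs c V(1) False by auto
          show "successively ?adj (y1 # c1 # y2 # c2 # rs)"
            using rs_path c V by (auto intro!: adj)
          show "distinct (y1 # c1 # y2 # c2 # rs)" using rs c V by auto
          show "{s1, hd (y1 # c1 # y2 # c2 # rs)} \<in> ?E"
            using s1 V by (auto intro!: adj)
        qed (use s1 s2 last in auto)
      qed
    qed
  qed
qed

section \<open>Recognising joins and disjoint unions up to isomorphism\<close>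

definition induce :: "'a graph \<Rightarrow> 'a set \<Rightarrow> 'a graph" where
  "induce G A = Graph A {e \<in> edges G. e \<subseteq> A}"

lemma verts_induce [simp]: "verts (induce G A) = A"
  by (simp add: induce_def)

lemma edge_induce [simp]: "{a, b} \<in> edges (induce G A) \<longleftrightarrow> {a, b} \<in> edges G \<and> a \<in> A \<and> b \<in> A"
  by (auto simp: induce_def)

lemma verts_disjoint_union [simp]: "verts (disjoint_union G H) = verts G <+> verts H"
  by (simp add: disjoint_union_def)

lemma verts_join [simp]: "verts (graph_join G H) = verts G <+> verts H"
  by (simp add: graph_join_def)

lemma edge_disjoint_union:
  "{Inl a, Inl b} \<in> edges (disjoint_union G H) \<longleftrightarrow> {a, b} \<in> edges G"
  "{Inr c, Inr d} \<in> edges (disjoint_union G H) \<longleftrightarrow> {c, d} \<in> edges H"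
  "{Inl a, Inr d} \<notin> edges (disjoint_union G H)"
  "{Inr d, Inl a} \<notin> edges (disjoint_union G H)"
proof -
  have l: "{Inl a, Inl b} = Inl ` {a, b}" and r: "{Inr c, Inr d} = Inr ` {c, d}" by auto
  have inj: "inj ((`) (Inl :: 'a \<Rightarrow> 'a + 'b))" "inj ((`) (Inr :: 'b \<Rightarrow> 'a + 'b))"
    by (auto intro!: injI simp: inj_image_eq_iff)
  have no_r: "Inl ` {a, b} \<notin> (`) Inr ` edges H" and no_l: "Inr ` {c, d} \<notin> (`) Inl ` edges G"
    by blast+
  show "{Inl a, Inl b} \<in> edges (disjoint_union G H) \<longleftrightarrow> {a, b} \<in> edges G"
    unfolding l using no_r inj_image_mem_iff[OF inj(1)]
    by (simp add: disjoint_union_def del: image_insert image_empty)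
  show "{Inr c, Inr d} \<in> edges (disjoint_union G H) \<longleftrightarrow> {c, d} \<in> edges H"
    unfolding r using no_l inj_image_mem_iff[OF inj(2)]
    by (simp add: disjoint_union_def del: image_insert image_empty)
  show mixed: "{Inl a, Inr d} \<notin> edges (disjoint_union G H)"
    unfolding disjoint_union_def by (auto dest!: equalityD1)
  then show "{Inr d, Inl a} \<notin> edges (disjoint_union G H)" by (simp add: insert_commute)
qed

lemma edge_join:
  "{Inl a, Inl b} \<in> edges (graph_join G H) \<longleftrightarrow> {a, b} \<in> edges G"
  "{Inr c, Inr d} \<in> edges (graph_join G H) \<longleftrightarrow> {c, d} \<in> edges H"
  "{Inl a, Inr d} \<in> edges (graph_join G H) \<longleftrightarrow> a \<in> verts G \<and> d \<in> verts H"
  "{Inr d, Inl a} \<in> edges (graph_join G H) \<longleftrightarrow> a \<in> verts G \<and> d \<in> verts H"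
  by (auto simp: graph_join_def edge_disjoint_union doubleton_eq_iff)

text \<open>The common part of the recognition of joins and of disjoint unions: \<open>K\<close> is a graph on the disjoint
  union of the vertex sets that restricts to \<open>G1\<close> and \<open>G2\<close>, and between the two sides \<open>G\<close> and \<open>K\<close>
  have either all edges or none.\<close>

lemma isomorphic_sum:
  assumes V: "verts G = A \<union> B" "A \<inter> B = {}"
    and iso: "isomorphic (induce G A) G1" "isomorphic (induce G B) G2"
    and K: "verts K = verts G1 <+> verts G2"
      "\<And>a b. {Inl a, Inl b} \<in> edges K \<longleftrightarrow> {a, b} \<in> edges G1"
      "\<And>c d. {Inr c, Inr d} \<in> edges K \<longleftrightarrow> {c, d} \<in> edges G2"
    and cross: "\<And>a b c d. a \<in> A \<Longrightarrow> b \<in> B \<Longrightarrow> c \<in> verts G1 \<Longrightarrow> d \<in> verts G2 \<Longrightarrow>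
      {a, b} \<in> edges G \<longleftrightarrow> {Inl c, Inr d} \<in> edges K"
  shows "isomorphic G K"
proof -
  obtain f where f: "bij_betw f A (verts G1)"
    "\<And>u v. u \<in> A \<Longrightarrow> v \<in> A \<Longrightarrow> {u, v} \<in> edges G \<longleftrightarrow> {f u, f v} \<in> edges G1"
    using iso(1) by (auto simp: isomorphic_def)
  obtain g where g: "bij_betw g B (verts G2)"
    "\<And>u v. u \<in> B \<Longrightarrow> v \<in> B \<Longrightarrow> {u, v} \<in> edges G \<longleftrightarrow> {g u, g v} \<in> edges G2"
    using iso(2) by (auto simp: isomorphic_def)
  define h where "h = (\<lambda>x. if x \<in> A then Inl (f x) else Inr (g x))"
  have hB: "h x = Inr (g x)" if "x \<in> B" for x using that V(2) by (auto simp: h_def)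
  have hA: "h x = Inl (f x)" if "x \<in> A" for x using that by (simp add: h_def)
  have "bij_betw h A (Inl ` verts G1)"
    using f(1) hA by (auto simp: bij_betw_def inj_on_def)
  moreover have "bij_betw h B (Inr ` verts G2)"
    using g(1) hB by (auto simp: bij_betw_def inj_on_def)
  ultimately have "bij_betw h (A \<union> B) (Inl ` verts G1 \<union> Inr ` verts G2)"
    by (rule bij_betw_combine) auto
  then have "bij_betw h (verts G) (verts K)" by (simp add: V K(1) Plus_def)
  moreover have "{u, v} \<in> edges G \<longleftrightarrow> {h u, h v} \<in> edges K" if uv: "u \<in> verts G" "v \<in> verts G" for u v
  proof -
    have fg: "f a \<in> verts G1" "g b \<in> verts G2" if "a \<in> A" "b \<in> B" for a b
      using that f(1) g(1) by (auto simp: bij_betw_def)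
    consider "u \<in> A" "v \<in> A" | "u \<in> B" "v \<in> B" | "u \<in> A" "v \<in> B" | "u \<in> B" "v \<in> A"
      using uv unfolding V(1) by blast
    then show ?thesis
    proof cases
      case 4
      then show ?thesis
        using cross[OF 4(2,1) fg[OF 4(2,1)]] by (simp add: hA hB insert_commute)
    qed (use f g K cross fg in \<open>simp_all add: hA hB\<close>)
  qed
  ultimately show ?thesis unfolding isomorphic_def by blast
qed

lemma isomorphic_join:
  assumes "verts G = A \<union> B" "A \<inter> B = {}" "isomorphic (induce G A) G1" "isomorphic (induce G B) G2"
    "\<And>a b. a \<in> A \<Longrightarrow> b \<in> B \<Longrightarrow> {a, b} \<in> edges G"
  shows "isomorphic G (graph_join G1 G2)"
  using assms(5) by (intro isomorphic_sum[OF assms(1-4)]) (simp_all add: edge_join)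

lemma isomorphic_disjoint_union:
  assumes "verts G = A \<union> B" "A \<inter> B = {}" "isomorphic (induce G A) G1" "isomorphic (induce G B) G2"
    "\<And>a b. a \<in> A \<Longrightarrow> b \<in> B \<Longrightarrow> {a, b} \<notin> edges G"
  shows "isomorphic G (disjoint_union G1 G2)"
  using assms(5)
  by (intro isomorphic_sum[OF assms(1-4)]) (simp_all add: edge_disjoint_union)

lemma isomorphic_complete:
  assumes "simple_graph G" "finite A" "card A = n"
    and "\<And>a b. a \<in> A \<Longrightarrow> b \<in> A \<Longrightarrow> a \<noteq> b \<Longrightarrow> {a, b} \<in> edges G"
  shows "isomorphic (induce G A) (complete_graph n)"
proof -
  obtain f where f: "bij_betw f A {0..<n}" using ex_bij_betw_finite_nat[OF assms(2)] assms(3) by auto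
  have edge: "{u, v} \<in> edges (complete_graph n) \<longleftrightarrow> u < n \<and> v < n \<and> u \<noteq> v" for u v
    by (auto simp: complete_graph_def doubleton_eq_iff)
  have "{u, v} \<in> edges G \<longleftrightarrow> {f u, f v} \<in> edges (complete_graph n)" if "u \<in> A" "v \<in> A" for u v
    using that f assms(4)[OF that] edgeD(3)[OF assms(1), of u v]
    by (auto simp: edge bij_betw_def inj_on_def)
  then show ?thesis
    using f unfolding isomorphic_def by (intro exI[of _ f]) (auto simp: complete_graph_def lessThan_atLeast0)
qed

lemma isomorphic_two_copies:
  assumes "simple_graph G" "y1 \<noteq> y2" "{y1, y2} \<notin> edges G"
  shows "isomorphic (induce G {y1, y2}) (copies 2 (complete_graph 1))"
proof -
  let ?f = "\<lambda>x. (if x = y1 then 0 else 1 :: nat, 0 :: nat)"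
  have "edges (copies 2 (complete_graph 1)) = {}" by (auto simp: copies_def complete_graph_def)
  moreover have "verts (copies 2 (complete_graph 1)) = {(0, 0), (1, 0)}"
    by (auto simp: copies_def complete_graph_def)
  moreover have "bij_betw ?f {y1, y2} {(0, 0), (1, 0)}"
    using assms(2) by (auto simp: bij_betw_def inj_on_def)
  moreover have "{u, v} \<notin> edges G" if "u \<in> {y1, y2}" "v \<in> {y1, y2}" for u v
    using that assms edgeD(3)[OF assms(1), of u v] by (auto simp: insert_commute)
  ultimately show ?thesis
    unfolding isomorphic_def by (intro exI[of _ ?f]) auto
qed

lemma induce_induce: "B \<subseteq> A \<Longrightarrow> induce (induce G A) B = induce G B"
  by (auto simp: induce_def)

section \<open>Complement and closure\<close>

lemma simple_complement: "simple_graph G \<Longrightarrow> simple_graph (graph_complement G)"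
  by (auto simp: simple_graph_def graph_complement_def)

lemma verts_complement [simp]: "verts (graph_complement G) = verts G"
  by (simp add: graph_complement_def)

lemma edge_complement:
  "{u, v} \<in> edges (graph_complement G) \<longleftrightarrow> u \<in> verts G \<and> v \<in> verts G \<and> u \<noteq> v \<and> {u, v} \<notin> edges G"
  by (auto simp: graph_complement_def doubleton_eq_iff insert_commute)

lemma degree_complement:
  assumes "simple_graph G" "v \<in> verts G"
  shows "degree (graph_complement G) v + degree G v + 1 = card (verts G)"
proof -
  let ?C = "graph_complement G"
  have fin: "finite (verts G)" using assms by (simp add: simple_graph_def)
  have "verts G - {v} = nbrs ?C v \<union> nbrs G v" "nbrs ?C v \<inter> nbrs G v = {}"
    using assms nbrs_subset[OF assms(1), of v] by (auto simp: nbrs_def edge_complement)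
  then have "card (verts G - {v}) = degree ?C v + degree G v"
    using assms finite_nbrs[OF assms(1)] finite_nbrs[OF simple_complement[OF assms(1)]]
    by (simp add: degree_eq_card_nbrs simple_complement card_Un_disjoint)
  moreover have "card (verts G) = card (verts G - {v}) + 1"
    using assms fin card_Suc_Diff1[of "verts G" v] by simp
  ultimately show ?thesis by simp
qed

lemma closure_steps_mono: "(closure_step l)\<^sup>*\<^sup>* G H \<Longrightarrow> edges G \<subseteq> edges H"
  by (induction rule: rtranclp_induct) (auto simp: closure_step_def)

lemma graph_closure_props:
  assumes "simple_graph G"
  shows "(closure_step l)\<^sup>*\<^sup>* G (graph_closure l G)" "\<nexists>H. closure_step l (graph_closure l G) H"
  using theI'[OF closure_unique[OF assms]] unfolding graph_closure_def by blast+

section \<open>The sufficient condition\<close>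

theorem theorem4p2:
  fixes G :: "'a graph" and n k :: nat
  assumes "2 \<le> k" and "k + 17 \<le> n"
    and "simple_graph G" and "connected_graph G" and "graph_order G = n"
    and "k + 1 \<le> min_degree G"
    and "int (hyper_Zagreb (graph_complement G)) \<le> (int n - int k)\<^sup>2 * (3 * (int n - int k) - 11)"
  shows "leaf_connected k G \<or>
    isomorphic (graph_closure (n + k - 1) G)
      (graph_join (complete_graph k) (disjoint_union (complete_graph (n - k - 2)) (complete_graph 2))) \<or>
    isomorphic (graph_closure (n + k - 1) G)
      (graph_join (complete_graph 3) (disjoint_union (complete_graph (n - 5)) (copies 2 (complete_graph 1))))"
proof -
  define l where "l = n + k - 1"
  define H where "H = graph_closure l G"
  define F where "F = graph_complement H"
  define m where "m = n - k"
  let ?V = "verts G"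
  have m: "17 \<le> m" "int m = int n - int k" "n = m + k" using assms(2) by (auto simp: m_def)
  have cV: "card ?V = n" using assms(5) by (simp add: graph_order_def)
  have finV: "finite ?V" using assms(3) by (simp add: simple_graph_def)
  have steps: "(closure_step l)\<^sup>*\<^sup>* G H" and closed: "\<nexists>H'. closure_step l H H'"
    using graph_closure_props[OF assms(3)] by (auto simp: H_def)
  have H: "simple_graph H" "verts H = ?V"
    using closure_steps_simple_graph[OF steps assms(3)] by auto
  have GH: "edges G \<subseteq> edges H" by (rule closure_steps_mono[OF steps])
  have F: "simple_graph F" "verts F = ?V"
    using simple_complement[OF H(1)] H(2) by (auto simp: F_def)
  have dF: "degree F v + degree H v + 1 = n" if "v \<in> ?V" for v
    using degree_complement[OF H(1), of v] that H(2) cV by (simp add: F_def)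
  have edgeH: "{a, b} \<in> edges H \<longleftrightarrow> {a, b} \<notin> edges F" if "a \<in> ?V" "b \<in> ?V" "a \<noteq> b" for a b
    using that H(2) by (simp add: F_def edge_complement)

  \<comment> \<open>a nonadjacent pair of degree sum at least \<open>l\<close> would allow another closure step\<close>
  have ore: "m \<le> degree F u + degree F v" if "{u, v} \<in> edges F" for u v
  proof -
    have uv: "u \<in> ?V" "v \<in> ?V" "u \<noteq> v" "{u, v} \<notin> edges H"
      using that H(2) by (auto simp: F_def edge_complement)
    then have "\<not> l \<le> degree H u + degree H v"
      using closed H(2) unfolding closure_step_def by blast
    then show ?thesis using dF[OF uv(1)] dF[OF uv(2)] assms(1) by (simp add: l_def m_def)
  qed
  have max: "degree F v \<le> m - 2" if "v \<in> verts F" for v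
  proof -
    have v: "v \<in> ?V" using that F(2) by simp
    have "min_degree G \<le> degree G v"
      unfolding min_degree_def using v finV by (intro Min_le) auto
    with assms(6) have "k + 1 \<le> degree G v" by (rule le_trans)
    also have "\<dots> \<le> degree H v"
      unfolding degree_def using GH finite_edges[OF H(1)] by (intro card_mono) auto
    finally show ?thesis using dF[OF v] by (simp add: m_def)
  qed
  have "edges F \<subseteq> edges (graph_complement G)"
    using GH H(2) by (auto simp: F_def graph_complement_def)
  then have "m * (\<Sum>v\<in>verts F. (degree F v)\<^sup>2) \<le> hyper_Zagreb (graph_complement G)"
    using hyper_Zagreb_ge[OF F(1) ore] hyper_Zagreb_mono[OF simple_complement[OF assms(3)]]
    by (meson le_trans)
  then have "int (m * (\<Sum>v\<in>verts F. (degree F v)\<^sup>2)) \<le> (int m)\<^sup>2 * (3 * int m - 11)"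
    using assms(7) unfolding m(2)[symmetric] by linarith
  then have "int m * int (\<Sum>v\<in>verts F. (degree F v)\<^sup>2) \<le> int m * (3 * (int m)\<^sup>2 - 11 * int m)"
    by (simp add: power2_eq_square algebra_simps)
  then have sum: "int (\<Sum>v\<in>verts F. (degree F v)\<^sup>2) \<le> 3 * (int m)\<^sup>2 - 11 * int m"
    using m(1) by (simp only: mult_le_cancel_left_pos of_nat_0_less_iff)

  have leaf_connectedI: "leaf_connected k G"
    if trees: "\<And>S. S \<subseteq> ?V \<Longrightarrow> card S = k \<Longrightarrow> \<exists>T. leaf_tree H S T"
  proof -
    have "\<exists>T. spanning_tree T G \<and> leaves T = S" if S: "S \<subseteq> ?V" "card S = k" for S
    proof -
      have "\<exists>T. leaf_tree G S T"
        using leaf_tree_closure[OF steps assms(3) _ trees[OF S]] S(2) cV by (simp add: l_def)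
      then show ?thesis using leaf_tree_spanning[OF assms(3)] by blast
    qed
    then show ?thesis using assms(2,5) by (simp add: leaf_connected_def)
  qed
  show ?thesis
  proof (cases "edges F = {}")
    case True
    have "\<exists>T. leaf_tree H S T" if S: "S \<subseteq> ?V" "card S = k" for S
      using S cV assms(1,2) H edgeH True by (intro complete_leaf_tree) auto
    then show ?thesis using leaf_connectedI by blast
  next
    case False
    obtain y1 y2 Z where y: "y1 \<noteq> y2" "y1 \<in> ?V" "y2 \<in> ?V" "Z \<subseteq> ?V - {y1, y2}"
      and cZ: "card Z = (if {y1, y2} \<in> edges F then m - 3 else m - 2)"
      and EF: "edges F - {{y1, y2}} = {{y, z} |y z. y \<in> {y1, y2} \<and> z \<in> Z}"
    proof (rule sparse_complement_structure[OF F(1) m(1) _ _ sum False])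
      show "m \<le> degree F u + degree F v" if "{u, v} \<in> edges F" for u v using that by (rule ore)
      show "degree F v \<le> m - 2" if "v \<in> verts F" for v using that by (rule max)
    qed (simp add: F(2))
    define U where "U = ?V - Z - {y1, y2}"
    have finZ: "finite Z" using y(4) finV finite_subset by blast
    have VU: "?V = U \<union> (Z \<union> {y1, y2})" "U \<inter> (Z \<union> {y1, y2}) = {}" using y by (auto simp: U_def)
    have "card ?V = card U + card (Z \<union> {y1, y2})"
      using finV finZ VU(2) by (subst VU(1), intro card_Un_disjoint) (auto simp: U_def)
    also have "card (Z \<union> {y1, y2}) = card Z + 2"
      using finZ y by (subst card_Un_disjoint) auto
    finally have cU: "card U + card Z + 2 = n" using cV by simp
    have adj: "{a, b} \<in> edges H"
      if "a \<in> ?V" "b \<in> ?V" "a \<noteq> b" "a \<in> U \<or> b \<in> U \<or> a \<in> Z \<and> b \<in> Z" for a b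
    proof -
      have "{a, b} \<notin> edges F - {{y1, y2}}" "{a, b} \<noteq> {y1, y2}"
        unfolding EF using that(4) y VU(2) by (auto simp: doubleton_eq_iff)
      then show ?thesis using edgeH[OF that(1-3)] by blast
    qed
    have nonadj: "{z, y} \<notin> edges H" if "z \<in> Z" "y \<in> {y1, y2}" for z y
    proof -
      have "{y, z} \<in> edges F - {{y1, y2}}" unfolding EF using that by blast
      then show ?thesis using edgeH[of z y] that y by (auto simp: insert_commute)
    qed
    have join: "isomorphic H (graph_join (complete_graph (card U)) (disjoint_union (complete_graph (card Z)) K))"
      if "isomorphic (induce H {y1, y2}) K" for K :: "'b graph"
    proof (rule isomorphic_join)
      show "verts H = U \<union> (Z \<union> {y1, y2})" using VU(1) H(2) by simp
      show "isomorphic (induce H U) (complete_graph (card U))"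
        using finV adj by (intro isomorphic_complete[OF H(1)]) (auto simp: U_def)
      show "isomorphic (induce H (Z \<union> {y1, y2})) (disjoint_union (complete_graph (card Z)) K)"
      proof (rule isomorphic_disjoint_union)
        have "isomorphic (induce H Z) (complete_graph (card Z))"
          using finZ adj y(4) by (intro isomorphic_complete[OF H(1)]) auto
        then show "isomorphic (induce (induce H (Z \<union> {y1, y2})) Z) (complete_graph (card Z))"
          by (subst induce_induce) auto
        show "isomorphic (induce (induce H (Z \<union> {y1, y2})) {y1, y2}) K"
          using that by (subst induce_induce) auto
      qed (use y nonadj in auto)
      show "{a, b} \<in> edges H" if "a \<in> U" "b \<in> Z \<union> {y1, y2}" for a b
        using that VU by (intro adj) auto
    qed (rule VU(2))
    show ?thesis
    proof (cases "{y1, y2} \<in> edges F")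
      case False
      then have "{y1, y2} \<in> edges H" using edgeH y by simp
      then have "isomorphic (induce H {y1, y2}) (complete_graph 2)"
        using y by (intro isomorphic_complete[OF H(1)]) (auto simp: insert_commute)
      moreover have "card Z = n - k - 2" "card U = k" using False cZ cU m by auto
      ultimately show ?thesis using join[of "complete_graph 2"] by (simp add: H_def l_def)
    next
      case True
      then have yH: "{y1, y2} \<notin> edges H" using edgeH y by simp
      have c: "card Z = m - 3" "card U = k + 1" using True cZ cU m by auto
      show ?thesis
      proof (cases "k = 2")
        case True
        then have "card Z = n - 5" "card U = 3" using c m by auto
        then show ?thesis
          using join[OF isomorphic_two_copies[OF H(1) y(1) yH]] by (simp add: H_def l_def)
      next
        case False
        have "\<exists>T. leaf_tree H S T" if S: "S \<subseteq> ?V" "card S = k" for S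
        proof (rule twins_leaf_tree[OF H(1)])
          show "verts H = U \<union> Z \<union> {y1, y2}" using VU(1) H(2) by auto
          show "Z \<noteq> {}" using c m by auto
          show "{a, b} \<in> edges H" if "a \<in> verts H" "b \<in> verts H" "a \<noteq> b"
            "a \<in> U \<or> b \<in> U \<or> a \<in> Z \<and> b \<in> Z" for a b
            using adj that H(2) by simp
        qed (use VU(2) y S H(2) c False assms(1) in auto)
        then show ?thesis using leaf_connectedI by blast
      qed
    qed
  qed
qed

end
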